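(* Let $X$ be a compact metrizable space, let $Y$ be a Tychonoff space, and suppose that $\varphi:C_p(X)\to C_p(Y)$ is a uniformly continuous surjection which is $c$-good for some $c>0$. Then $Y$ is compact metrizable. Moreover: (a) if $X$ is zero-dimensional, then $Y$ is zero-dimensional; (b) if $X$ is strongly countable-dimensional, then $Y$ is strongly countable-dimensional.
   Context: For a Tychonoff space $X$, $C_p(X)$ is the space of all continuous real-valued functions on $X$ with the topology of pointwise convergence; $\|f\|=\sup_{x\in X}|f(x)|\in[0,\infty]$ denotes the supremum (extended) norm on $C_p(X)$. A map $\varphi:C_p(X)\to C_p(Y)$ is uniformly continuous (with respect to the pointwise topologies) if for each open neighborhood $U$ of the zero function in $C_p(Y)$ there is an open neighborhood $V$ of the zero function in $C_p(X)$ such that $f-g\in V$ implies $\varphi(f)-\varphi(g)\in U$. The map $\varphi$ is $c$-good if for every $g\in C_p(Y)$ there is $f\in C_p(X)$ with $\varphi(f)=g$ and $\|f\|\le c\|g\|$. A normal space is strongly countable-dimensional if it is a countable union of closed finite-dimensional subspaces (covering dimension). *)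

theory Defs
  imports "HOL-Analysis.Analysis"
begin

definition tychonoff_space :: "'a topology \<Rightarrow> bool" where
  "tychonoff_space X \<longleftrightarrow> completely_regular_space X \<and> Hausdorff_space X"

text \<open>
  The points of \<open>Cp X\<close> are the continuous functions on \<open>X\<close> in extensional form, that is with value
  \<^term>\<open>undefined\<close> outside \<open>topspace X\<close>, as required by \<^const>\<open>product_topology\<close>. This is why the
  zero function and differences below are restricted to \<open>topspace X\<close>.
\<close>

definition Cp :: "'a topology \<Rightarrow> ('a \<Rightarrow> real) topology" where
  "Cp X = subtopology (product_topology (\<lambda>_. euclideanreal) (topspace X))
            {f. continuous_map X euclideanreal f}"

definition Cp_zero :: "'a topology \<Rightarrow> 'a \<Rightarrow> real" where
  "Cp_zero X = (\<lambda>x\<in>topspace X. 0)"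

definition Cp_diff :: "'a topology \<Rightarrow> ('a \<Rightarrow> real) \<Rightarrow> ('a \<Rightarrow> real) \<Rightarrow> 'a \<Rightarrow> real" where
  "Cp_diff X f g = (\<lambda>x\<in>topspace X. f x - g x)"

text \<open>Values in \<^typ>\<open>ennreal\<close>: the norm may be infinite, and it is \<open>0\<close> if \<open>X\<close> is empty.\<close>

definition sup_norm :: "'a topology \<Rightarrow> ('a \<Rightarrow> real) \<Rightarrow> ennreal" where
  "sup_norm X f = (SUP x\<in>topspace X. ennreal \<bar>f x\<bar>)"

definition Cp_uniformly_continuous ::
  "'a topology \<Rightarrow> 'b topology \<Rightarrow> (('a \<Rightarrow> real) \<Rightarrow> ('b \<Rightarrow> real)) \<Rightarrow> bool" where
  "Cp_uniformly_continuous X Y \<phi> \<longleftrightarrow>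
     (\<forall>U. openin (Cp Y) U \<and> Cp_zero Y \<in> U \<longrightarrow>
        (\<exists>V. openin (Cp X) V \<and> Cp_zero X \<in> V \<and>
           (\<forall>f\<in>topspace (Cp X). \<forall>g\<in>topspace (Cp X).
              Cp_diff X f g \<in> V \<longrightarrow> Cp_diff Y (\<phi> f) (\<phi> g) \<in> U)))"

definition c_good ::
  "real \<Rightarrow> 'a topology \<Rightarrow> 'b topology \<Rightarrow> (('a \<Rightarrow> real) \<Rightarrow> ('b \<Rightarrow> real)) \<Rightarrow> bool" where
  "c_good c X Y \<phi> \<longleftrightarrow>
     (\<forall>g\<in>topspace (Cp Y). \<exists>f\<in>topspace (Cp X).
        \<phi> f = g \<and> sup_norm X f \<le> ennreal c * sup_norm Y g)"

text \<open>
  \<open>dim X \<le> n\<close> for the covering dimension: every finite open cover has a finite open refinement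
  of order at most \<open>n\<close>, i.e. with no point in more than \<open>n + 1\<close> members. This form, with open
  rather than functionally open covers, is the covering dimension of normal spaces and is used
  only for those.
\<close>

definition covering_dim_le :: "'a topology \<Rightarrow> nat \<Rightarrow> bool" where
  "covering_dim_le X n \<longleftrightarrow>
     (\<forall>\<U>. finite \<U> \<and> (\<forall>U\<in>\<U>. openin X U) \<and> \<Union>\<U> = topspace X \<longrightarrow>
        (\<exists>\<V>. finite \<V> \<and> (\<forall>V\<in>\<V>. openin X V) \<and> \<Union>\<V> = topspace X \<and>
             (\<forall>V\<in>\<V>. \<exists>U\<in>\<U>. V \<subseteq> U) \<and>
             (\<forall>x\<in>topspace X. card {V\<in>\<V>. x \<in> V} \<le> n + 1)))"

text \<open>The empty space, of dimension \<open>-1\<close>, is counted as zero-dimensional.\<close>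

definition zero_dimensional :: "'a topology \<Rightarrow> bool" where
  "zero_dimensional X \<longleftrightarrow> normal_space X \<and> covering_dim_le X 0"

definition strongly_countable_dimensional :: "'a topology \<Rightarrow> bool" where
  "strongly_countable_dimensional X \<longleftrightarrow>
     normal_space X \<and>
     (\<exists>A :: nat \<Rightarrow> 'a set.
        (\<forall>i. closedin X (A i) \<and> (\<exists>n. covering_dim_le (subtopology X (A i)) n)) \<and>
        (\<Union>i. A i) = topspace X)"

end

theory Submission
  imports Defs
begin

text \<open>
  For a point \<open>y\<close> of \<open>Y\<close>, uniform continuity of \<open>\<phi>\<close> shows that \<open>\<phi> f y\<close> is controlled, up to a bounded
  error, by the values of \<open>f\<close> on a finite set, a support of \<open>y\<close>. Everything rests on Gul'ko's idea of
  letting \<open>y\<close> vary with its support (\<open>support_bound\<close>).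

  Compactness and metrizability of \<open>Y\<close>. Functions on the compact space \<open>X\<close> are bounded, and the
  image of a norm-bounded set is pointwise bounded by the finite supports; if \<open>Y\<close> carried an unbounded
  continuous function, one could write down a continuous function escaping all these bounds. So
  \<open>Y\<close> is pseudocompact (\<open>pseudocompact_Y\<close>). Since \<open>Cp X\<close> is separable, countably many functions
  separate the points of \<open>Y\<close>, and a pseudocompact Tychonoff space with this property embeds as a
  closed set into a compact box in \<open>\<real>\<^sup>\<omega>\<close> (\<open>compact_metrizable_if_pseudocompact\<close>).

  Dimension. If \<open>K\<close> and \<open>L\<close> support \<open>y\<close>, so does their intersection, with twice the error
  (\<open>support_bound_Int\<close>). Therefore \<open>Y\<close> splits into countably many strata on which supports of the
  least size \<open>q\<close> are unique, and on suitable closed pieces the support, listed as a \<open>q\<close>-tuple, is a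
  continuous function of \<open>y\<close> into a product of closed subsets of \<open>X\<close>. By \<open>c\<close>-goodness this function
  is finite-to-one (\<open>finitely_many_points_with_support\<close>): the \<open>2 ^ m\<close> sign patterns on \<open>m\<close>
  points with the same support lift to functions of bounded norm that are separated on this
  support, and there is room for only finitely many. A continuous finite-to-one map from a compact space does not
  lower the dimension (\<open>covering_dim_le_finite_to_one\<close>), and finite products of compact metrizable
  spaces of finite dimension have finite dimension, with \<open>0\<close> staying \<open>0\<close>
  (\<open>covering_dim_le_product\<close>). So the pieces have finite dimension if \<open>X\<close> is a countable union of
  finite-dimensional closed sets, which is (b), and dimension \<open>0\<close> if \<open>X\<close> is zero-dimensional, in
  which case the countable sum theorem (\<open>dim_0_countable_sum\<close>) gives (a).
\<close>

section \<open>Covering dimension of compact spaces\<close>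

lemma covering_dim_leE:
  assumes dim: "covering_dim_le X n" and \<U>: "finite \<U>" "\<forall>U\<in>\<U>. openin X U" "\<Union>\<U> = topspace X"
  obtains \<V> where "finite \<V>" "\<forall>V\<in>\<V>. openin X V" "\<Union>\<V> = topspace X"
    "\<forall>V\<in>\<V>. \<exists>U\<in>\<U>. V \<subseteq> U" "\<forall>x\<in>topspace X. card {V\<in>\<V>. x \<in> V} \<le> n + 1"
proof -
  note dim[unfolded covering_dim_le_def, THEN spec, THEN mp, OF conjI, OF \<U>(1) conjI, OF \<U>(2,3)]
  then show thesis by (elim exE conjE) (rule that)
qed

lemma compact_space_finite_subcover:
  assumes "compact_space X" "\<And>U. U \<in> \<U> \<Longrightarrow> openin X U" "topspace X \<subseteq> \<Union>\<U>"
  obtains \<F> where "finite \<F>" "\<F> \<subseteq> \<U>" "topspace X \<subseteq> \<Union>\<F>"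
proof -
  have "\<exists>\<F>. finite \<F> \<and> \<F> \<subseteq> \<U> \<and> topspace X \<subseteq> \<Union>\<F>"
    using assms by (auto simp: compact_space_alt)
  then show thesis by (elim exE conjE) (rule that)
qed

lemma covering_dim_le_refine:
  assumes "covering_dim_le X n" "compact_space X"
    and op: "\<And>U. U \<in> \<U> \<Longrightarrow> openin X U" and cov: "topspace X \<subseteq> \<Union>\<U>"
  obtains \<V> where "finite \<V>" "\<forall>V\<in>\<V>. openin X V" "\<Union>\<V> = topspace X"
    "\<forall>V\<in>\<V>. \<exists>U\<in>\<U>. V \<subseteq> U" "\<forall>x\<in>topspace X. card {V\<in>\<V>. x \<in> V} \<le> n + 1"
proof -
  obtain \<F> where \<F>: "finite \<F>" "\<F> \<subseteq> \<U>" "topspace X \<subseteq> \<Union>\<F>"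
    using assms(2) op cov by (rule compact_space_finite_subcover)
  have "\<Union>\<F> \<subseteq> topspace X"
    using \<F>(2) op openin_subset by (intro Union_least) blast
  then have UnF: "\<Union>\<F> = topspace X"
    using \<F>(3) by (rule subset_antisym)
  have opF: "\<forall>U\<in>\<F>. openin X U"
    using \<F> op by blast
  obtain \<V> where \<V>: "finite \<V>" "\<forall>V\<in>\<V>. openin X V" "\<Union>\<V> = topspace X"
      "\<forall>V\<in>\<V>. \<exists>U\<in>\<F>. V \<subseteq> U" "\<forall>x\<in>topspace X. card {V\<in>\<V>. x \<in> V} \<le> n + 1"
    by (rule covering_dim_leE[OF assms(1) \<F>(1) opF UnF])
  show thesis
  proof (rule that[of \<V>])
    show "\<forall>V\<in>\<V>. \<exists>U\<in>\<U>. V \<subseteq> U"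
      using \<V>(4) \<F>(2) by blast
  qed (use \<V> in auto)
qed

lemma covering_dim_le_closed_subspace:
  assumes dim: "covering_dim_le X n" and C: "closedin X C"
  shows "covering_dim_le (subtopology X C) n"
  unfolding covering_dim_le_def
proof (intro allI impI, elim conjE)
  fix \<U> assume \<U>: "finite \<U>" "\<forall>U\<in>\<U>. openin (subtopology X C) U" "\<Union>\<U> = topspace (subtopology X C)"
  have CX: "C \<subseteq> topspace X" using C closedin_subset by auto
  have "\<forall>U\<in>\<U>. \<exists>T. openin X T \<and> U = T \<inter> C"
    using \<U>(2) by (simp add: openin_subtopology)
  then obtain e where e: "\<And>U. U \<in> \<U> \<Longrightarrow> openin X (e U) \<and> U = e U \<inter> C"
    by metis
  let ?\<T> = "insert (topspace X - C) (e ` \<U>)"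
  have "finite ?\<T>" using \<U> by simp
  moreover have op: "\<forall>T\<in>?\<T>. openin X T" using e C by auto
  moreover have "\<Union>?\<T> = topspace X"
  proof
    show "\<Union>?\<T> \<subseteq> topspace X" using op by (metis Union_least openin_subset)
    have "C \<subseteq> \<Union>\<U>" using \<U>(3) CX by auto
    then show "topspace X \<subseteq> \<Union>?\<T>" using e by fastforce
  qed
  ultimately obtain \<V> where \<V>: "finite \<V>" "\<forall>V\<in>\<V>. openin X V" "\<Union>\<V> = topspace X"
      "\<forall>V\<in>\<V>. \<exists>T\<in>?\<T>. V \<subseteq> T" "\<forall>x\<in>topspace X. card {V\<in>\<V>. x \<in> V} \<le> n + 1"
    by (rule covering_dim_leE[OF dim])
  let ?\<W> = "(\<lambda>V. V \<inter> C) ` \<V> - {{}}"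
  show "\<exists>\<V>. finite \<V> \<and> (\<forall>V\<in>\<V>. openin (subtopology X C) V) \<and> \<Union>\<V> = topspace (subtopology X C) \<and>
          (\<forall>V\<in>\<V>. \<exists>U\<in>\<U>. V \<subseteq> U) \<and> (\<forall>x\<in>topspace (subtopology X C). card {V\<in>\<V>. x \<in> V} \<le> n + 1)"
  proof (intro exI[of _ ?\<W>] conjI ballI)
    show "finite ?\<W>" using \<V> by simp
    show "openin (subtopology X C) W" if "W \<in> ?\<W>" for W
      using that \<V>(2) by (auto simp: openin_subtopology)
    have "\<Union>?\<W> = \<Union>\<V> \<inter> C" by auto
    then show "\<Union>?\<W> = topspace (subtopology X C)" using \<V>(3) by simp
    show "\<exists>U\<in>\<U>. W \<subseteq> U" if W: "W \<in> ?\<W>" for W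
    proof -
      obtain V where V: "V \<in> \<V>" "W = V \<inter> C" "W \<noteq> {}" using W by auto
      obtain T where T: "T \<in> ?\<T>" "V \<subseteq> T" using bspec[OF \<V>(4) V(1)] by (elim bexE)
      moreover have "T \<noteq> topspace X - C" using T V by blast
      ultimately obtain U where "U \<in> \<U>" "T = e U" by auto
      then show ?thesis using e[of U] T V by blast
    qed
    show "card {W \<in> ?\<W>. x \<in> W} \<le> n + 1" if x: "x \<in> topspace (subtopology X C)" for x
    proof -
      have "{W \<in> ?\<W>. x \<in> W} \<subseteq> (\<lambda>V. V \<inter> C) ` {V\<in>\<V>. x \<in> V}" by auto
      then have "card {W \<in> ?\<W>. x \<in> W} \<le> card {V\<in>\<V>. x \<in> V}"
        using \<V>(1) by (intro surj_card_le) auto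
      also have "\<dots> \<le> n + 1" using \<V>(5) x by auto
      finally show ?thesis .
    qed
  qed
qed

lemma Hausdorff_disjoint_neighbourhoods:
  assumes "Hausdorff_space Z" "finite P" "P \<subseteq> topspace Z"
  obtains w where "\<And>p. p \<in> P \<Longrightarrow> openin Z (w p) \<and> p \<in> w p"
    "\<And>p q. \<lbrakk>p \<in> P; q \<in> P; p \<noteq> q\<rbrakk> \<Longrightarrow> w p \<inter> w q = {}"
proof -
  have "\<exists>U V. openin Z U \<and> openin Z V \<and> p \<in> U \<and> q \<in> V \<and> disjnt U V"
    if "p \<in> P" "q \<in> P" "p \<noteq> q" for p q
    using assms that unfolding Hausdorff_space_def by blast
  then obtain L R where LR: "\<And>p q. \<lbrakk>p \<in> P; q \<in> P; p \<noteq> q\<rbrakk> \<Longrightarrow>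
      openin Z (L p q) \<and> openin Z (R p q) \<and> p \<in> L p q \<and> q \<in> R p q \<and> disjnt (L p q) (R p q)"
    by metis
  define w where "w p = topspace Z \<inter> \<Inter>((\<lambda>q. L p q \<inter> R q p) ` (P - {p}))" for p
  show thesis
  proof
    fix p assume p: "p \<in> P"
    have "openin Z (w p)"
    proof (cases "P - {p} = {}")
      case True then show ?thesis unfolding w_def True by simp
    next
      case False
      then show ?thesis unfolding w_def
        using assms(2) LR p
        by (intro openin_Int openin_topspace openin_INT2) auto
    qed
    then show "openin Z (w p) \<and> p \<in> w p"
      using p assms(3) LR unfolding w_def by auto
  next
    fix p q assume "p \<in> P" "q \<in> P" "p \<noteq> q"
    then have "w p \<subseteq> L p q" "w q \<subseteq> R p q" "disjnt (L p q) (R p q)"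
      using LR unfolding w_def by auto
    then show "w p \<inter> w q = {}" unfolding disjnt_def by blast
  qed
qed

text \<open>
  A fibre of a finite-to-one map can be covered by pairwise disjoint open sets, each inside a
  member of a given cover; by compactness these sets contain the preimage of a neighbourhood of
  the base point. Pulling back a refinement of the cover by such neighbourhoods and cutting each
  preimage along its disjoint sets does not increase the order.
\<close>

lemma covering_dim_le_finite_to_one:
  assumes Z: "compact_space Z" "Hausdorff_space Z" and S: "compact_space S" "Hausdorff_space S"
    and k: "continuous_map Z S k"
    and fin: "\<And>s. s \<in> topspace S \<Longrightarrow> finite {z \<in> topspace Z. k z = s}"
    and dim: "covering_dim_le S n"
  shows "covering_dim_le Z n"
  unfolding covering_dim_le_def
proof (intro allI impI, elim conjE)
  fix \<U> assume \<U>: "finite \<U>" "\<forall>U\<in>\<U>. openin Z U" "\<Union>\<U> = topspace Z"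
  have clk: "closed_map Z S k"
    using k Z S by (simp add: continuous_imp_closed_map)
  define P where "P s = {z \<in> topspace Z. k z = s}" for s
  define good where "good s w N \<longleftrightarrow> (\<forall>p\<in>P s. openin Z (w p) \<and> (\<exists>U\<in>\<U>. w p \<subseteq> U)) \<and>
          (\<forall>p\<in>P s. \<forall>q\<in>P s. p \<noteq> q \<longrightarrow> w p \<inter> w q = {}) \<and> openin S N \<and> s \<in> N \<and>
          {z \<in> topspace Z. k z \<in> N} \<subseteq> \<Union>(w ` P s)" for s w N
  have "\<exists>w N. good s w N" if s: "s \<in> topspace S" for s
  proof -
    have Pf: "finite (P s)" "P s \<subseteq> topspace Z" using fin s unfolding P_def by auto
    obtain v where v: "\<And>p. p \<in> P s \<Longrightarrow> openin Z (v p) \<and> p \<in> v p"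
      "\<And>p q. \<lbrakk>p \<in> P s; q \<in> P s; p \<noteq> q\<rbrakk> \<Longrightarrow> v p \<inter> v q = {}"
      using Hausdorff_disjoint_neighbourhoods[OF Z(2) Pf] by metis
    have "\<forall>p\<in>P s. \<exists>U\<in>\<U>. p \<in> U" using Pf \<U>(3) by blast
    then obtain u where u: "\<And>p. p \<in> P s \<Longrightarrow> u p \<in> \<U> \<and> p \<in> u p" by metis
    define w where "w p = v p \<inter> u p" for p
    have w: "openin Z (w p)" "w p \<subseteq> u p" "p \<in> w p" "w p \<subseteq> v p" if "p \<in> P s" for p
      using v u that \<U>(2) unfolding w_def by auto
    have "openin Z (\<Union>(w ` P s))" using w by blast
    then have "closedin S (k ` (topspace Z - \<Union>(w ` P s)))"
      using clk unfolding closed_map_def by blast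
    then have oN: "openin S (topspace S - k ` (topspace Z - \<Union>(w ` P s)))" by blast
    have "s \<notin> k ` (topspace Z - \<Union>(w ` P s))"
      using w(3) unfolding P_def by blast
    moreover have "\<forall>p\<in>P s. openin Z (w p) \<and> (\<exists>U\<in>\<U>. w p \<subseteq> U)" using w(1,2) u by blast
    moreover have "\<forall>p\<in>P s. \<forall>q\<in>P s. p \<noteq> q \<longrightarrow> w p \<inter> w q = {}"
      using v(2) w(4) by blast
    moreover have "{z \<in> topspace Z. k z \<in> topspace S - k ` (topspace Z - \<Union>(w ` P s))} \<subseteq> \<Union>(w ` P s)"
      by blast
    ultimately show ?thesis using oN s unfolding good_def by blast
  qed
  then obtain w N where G: "\<And>s. s \<in> topspace S \<Longrightarrow> good s (w s) (N s)" by metis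
  have good: "openin Z (w s p) \<and> (\<exists>U\<in>\<U>. w s p \<subseteq> U)" if "s \<in> topspace S" "p \<in> P s" for s p
    using G[OF that(1), unfolded good_def, THEN conjunct1] that(2) by (rule bspec)
  have disj: "w s p \<inter> w s q = {}" if "s \<in> topspace S" "p \<in> P s" "q \<in> P s" "p \<noteq> q" for s p q
    using G[OF that(1), unfolded good_def, THEN conjunct2, THEN conjunct1] that(2-) by simp
  have N: "openin S (N s) \<and> s \<in> N s" if "s \<in> topspace S" for s
    using G[OF that(1)] unfolding good_def by simp
  have cov: "\<exists>p\<in>P s. z \<in> w s p" if "s \<in> topspace S" "z \<in> topspace Z" "k z \<in> N s" for s z
    using G[OF that(1), unfolded good_def, THEN conjunct2, THEN conjunct2, THEN conjunct2, THEN conjunct2]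
      that(2-) by blast
  have "\<And>T. T \<in> N ` topspace S \<Longrightarrow> openin S T" "topspace S \<subseteq> \<Union>(N ` topspace S)"
    using N by blast+
  then obtain \<V> where \<V>: "finite \<V>" "\<forall>V\<in>\<V>. openin S V" "\<Union>\<V> = topspace S"
    "\<forall>V\<in>\<V>. \<exists>U\<in>N ` topspace S. V \<subseteq> U"
    "\<forall>x\<in>topspace S. card {V\<in>\<V>. x \<in> V} \<le> n + 1"
    by (rule covering_dim_le_refine[OF dim S(1)])
  have "\<forall>V\<in>\<V>. \<exists>s. s \<in> topspace S \<and> V \<subseteq> N s"
    using \<V>(4) by auto
  then obtain c where c: "\<And>V. V \<in> \<V> \<Longrightarrow> c V \<in> topspace S \<and> V \<subseteq> N (c V)"
    unfolding bchoice_iff by blast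
  define piece where "piece V p = {z \<in> topspace Z. k z \<in> V} \<inter> w (c V) p" for V p
  let ?\<W> = "\<Union>V\<in>\<V>. piece V ` P (c V)"
  show "\<exists>\<V>. finite \<V> \<and> (\<forall>V\<in>\<V>. openin Z V) \<and> \<Union>\<V> = topspace Z \<and>
          (\<forall>V\<in>\<V>. \<exists>U\<in>\<U>. V \<subseteq> U) \<and> (\<forall>x\<in>topspace Z. card {V\<in>\<V>. x \<in> V} \<le> n + 1)"
  proof (intro exI[of _ ?\<W>] conjI ballI)
    show "finite ?\<W>" using \<V>(1) fin c unfolding P_def by auto
    show "openin Z W" if W: "W \<in> ?\<W>" for W
    proof -
      obtain V p where Vp: "V \<in> \<V>" "p \<in> P (c V)" "W = piece V p" using W by blast
      have "openin Z {z \<in> topspace Z. k z \<in> V}"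
        using k \<V>(2) Vp(1) by (simp add: openin_continuous_map_preimage)
      moreover have "openin Z (w (c V) p)" using good c Vp by blast
      ultimately show ?thesis unfolding Vp(3) piece_def by blast
    qed
    show "\<Union>?\<W> = topspace Z"
    proof
      show "\<Union>?\<W> \<subseteq> topspace Z" unfolding piece_def by blast
      show "topspace Z \<subseteq> \<Union>?\<W>"
      proof
        fix z assume z: "z \<in> topspace Z"
        then have "k z \<in> topspace S" using k by (auto simp: continuous_map_def)
        then obtain V where V: "V \<in> \<V>" "k z \<in> V" using \<V>(3) by blast
        then have "\<exists>p\<in>P (c V). z \<in> w (c V) p" using cov[of "c V" z] c[OF V(1)] z by blast
        then show "z \<in> \<Union>?\<W>" using V z unfolding piece_def by blast
      qed
    qed
    show "\<exists>U\<in>\<U>. W \<subseteq> U" if W: "W \<in> ?\<W>" for W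
    proof -
      obtain V p where Vp: "V \<in> \<V>" "p \<in> P (c V)" "W = piece V p" using W by blast
      then have "\<exists>U\<in>\<U>. w (c V) p \<subseteq> U" using good c by blast
      then show ?thesis unfolding Vp(3) piece_def by blast
    qed
    show "card {W \<in> ?\<W>. z \<in> W} \<le> n + 1" if z: "z \<in> topspace Z" for z
    proof -
      define pt where "pt V = (SOME p. p \<in> P (c V) \<and> z \<in> w (c V) p)" for V
      have pt: "pt V = p" if "V \<in> \<V>" "p \<in> P (c V)" "z \<in> w (c V) p" for V p
        unfolding pt_def
        by (rule some_equality) (use disj c that in blast)+
      have "{W \<in> ?\<W>. z \<in> W} \<subseteq> (\<lambda>V. piece V (pt V)) ` {V\<in>\<V>. k z \<in> V}"
      proof clarify
        fix V p assume *: "V \<in> \<V>" "p \<in> P (c V)" "z \<in> piece V p"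
        then have "pt V = p" "k z \<in> V" using pt unfolding piece_def by auto
        then show "piece V p \<in> (\<lambda>V. piece V (pt V)) ` {V\<in>\<V>. k z \<in> V}" using * by blast
      qed
      then have "card {W \<in> ?\<W>. z \<in> W} \<le> card {V\<in>\<V>. k z \<in> V}"
        using \<V>(1) by (intro surj_card_le) auto
      also have "k z \<in> topspace S" using k z by (auto simp: continuous_map_def)
      then have "card {V\<in>\<V>. k z \<in> V} \<le> n + 1" using \<V>(5) by blast
      finally show ?thesis .
    qed
  qed
qed

text \<open>
  A Lebesgue number argument: for some \<open>\<epsilon> > 0\<close>, every box of radius \<open>\<epsilon>\<close> lies in a member of the
  given cover of the product. So products of fine covers of the factors refine it. The order of such
  a product cover is the product of the orders. The resulting bound is crude compared with the
  sum of the dimensions, but it is finite, and it is \<open>0\<close> if all factors have dimension \<open>0\<close>.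
\<close>

lemma covering_dim_le_product:
  assumes I: "finite I" and comp: "\<And>i. i \<in> I \<Longrightarrow> compact_space (X i)"
    and met: "\<And>i. i \<in> I \<Longrightarrow> metrizable_space (X i)"
    and dim: "\<And>i. i \<in> I \<Longrightarrow> covering_dim_le (X i) (d i)"
  shows "covering_dim_le (product_topology X I) ((\<Prod>i\<in>I. d i + 1) - 1)"
  unfolding covering_dim_le_def
proof (intro allI impI, elim conjE)
  let ?P = "product_topology X I"
  fix \<U> assume \<U>: "finite \<U>" "\<forall>U\<in>\<U>. openin ?P U" "\<Union>\<U> = topspace ?P"
  have "\<exists>D. Metric_space (topspace (X i)) D \<and> X i = Metric_space.mtopology (topspace (X i)) D"
    if "i \<in> I" for i
    using met[OF that] unfolding metrizable_space_def by (metis Metric_space.topspace_mtopology)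
  then obtain D where D: "\<And>i. i \<in> I \<Longrightarrow> Metric_space (topspace (X i)) (D i)"
      and DX: "\<And>i. i \<in> I \<Longrightarrow> X i = Metric_space.mtopology (topspace (X i)) (D i)"
    by metis
  define B where "B i x r = Metric_space.mball (topspace (X i)) (D i) x r" for i x r
  have inB: "y \<in> B i x r \<longleftrightarrow> x \<in> topspace (X i) \<and> y \<in> topspace (X i) \<and> D i x y < r" if "i \<in> I" for i x y r
    using Metric_space.in_mball[OF D[OF that]] unfolding B_def by simp
  have opB: "openin (X i) (B i x r)" if "i \<in> I" for i x r
    using Metric_space.openin_mball[OF D[OF that]] DX[OF that] unfolding B_def by simp
  have tri: "D i x z \<le> D i x y + D i y z"
    if "i \<in> I" "x \<in> topspace (X i)" "y \<in> topspace (X i)" "z \<in> topspace (X i)" for i x y z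
    using Metric_space.triangle[OF D[OF that(1)]] that by blast
  have sym: "D i x y = D i y x" if "i \<in> I" for i x y
    using Metric_space.commute[OF D[OF that]] .
  have zero: "D i x x = 0" if "i \<in> I" "x \<in> topspace (X i)" for i x
    using Metric_space.mdist_zero[OF D[OF that(1)] that(2)] .
  \<comment> \<open>boxes of twice the needed radius, so that a box around any point of the smaller one still fits\<close>
  have "\<exists>r>0. \<exists>U\<in>\<U>. PiE I (\<lambda>i. B i (x i) (2 * r)) \<subseteq> U" if x: "x \<in> topspace ?P" for x
  proof -
    obtain U where U: "U \<in> \<U>" "x \<in> U" using \<U>(3) x by blast
    then obtain O' where O': "\<forall>i\<in>I. openin (X i) (O' i)" "x \<in> PiE I O'" "PiE I O' \<subseteq> U"
      using \<U>(2) unfolding openin_product_topology_alt by meson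
    have "\<exists>r>0. B i (x i) r \<subseteq> O' i" if i: "i \<in> I" for i
    proof -
      have "openin (Metric_space.mtopology (topspace (X i)) (D i)) (O' i)"
        using O'(1) DX i by metis
      then show ?thesis
        using O'(2) i unfolding Metric_space.openin_mtopology[OF D[OF i]] B_def
        by (meson PiE_mem)
    qed
    then obtain \<rho> where \<rho>: "\<And>i. i \<in> I \<Longrightarrow> \<rho> i > 0 \<and> B i (x i) (\<rho> i) \<subseteq> O' i" by metis
    define r where "r = Min (insert 1 (\<rho> ` I)) / 2"
    have "r > 0" unfolding r_def using I \<rho> by simp
    have "B i (x i) (2 * r) \<subseteq> O' i" if i: "i \<in> I" for i
    proof -
      have "2 * r \<le> \<rho> i" unfolding r_def using I i by simp
      then show ?thesis
        using \<rho>[OF i] Metric_space.mball_subset_concentric[OF D[OF i]] unfolding B_def by blast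
    qed
    then have "PiE I (\<lambda>i. B i (x i) (2 * r)) \<subseteq> PiE I O'"
      by (rule PiE_mono)
    then have "PiE I (\<lambda>i. B i (x i) (2 * r)) \<subseteq> U" using O'(3) by (rule order_trans)
    then show ?thesis using \<open>r > 0\<close> U(1) by (intro exI[of _ r] conjI bexI[of _ U])
  qed
  then obtain r where r: "\<And>x. x \<in> topspace ?P \<Longrightarrow>
      r x > 0 \<and> (\<exists>U\<in>\<U>. PiE I (\<lambda>i. B i (x i) (2 * r x)) \<subseteq> U)" by metis
  define box where "box x = PiE I (\<lambda>i. B i (x i) (r x))" for x
  have "openin ?P (box x)" for x
    unfolding box_def using I opB by (simp add: openin_PiE)
  moreover have "x \<in> box x" if "x \<in> topspace ?P" for x
    using that r[OF that] inB zero unfolding box_def by (auto simp: PiE_iff)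
  moreover have "compact_space ?P" using comp by (simp add: compact_space_product_topology)
  ultimately obtain \<F> where "finite \<F>" "\<F> \<subseteq> box ` topspace ?P" "topspace ?P \<subseteq> \<Union>\<F>"
    by (elim compact_space_finite_subcover[of ?P "box ` topspace ?P"]) blast+
  then obtain Q where Q: "finite Q" "Q \<subseteq> topspace ?P" "topspace ?P \<subseteq> \<Union>(box ` Q)"
    by (metis finite_subset_image)
  define \<epsilon> where "\<epsilon> = Min (insert 1 (r ` Q))"
  have \<epsilon>: "\<epsilon> > 0" "\<And>x. x \<in> Q \<Longrightarrow> \<epsilon> \<le> r x"
    unfolding \<epsilon>_def using Q r by auto
  have leb: "\<exists>U\<in>\<U>. PiE I (\<lambda>i. B i (y i) \<epsilon>) \<subseteq> U" if y: "y \<in> topspace ?P" for y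
  proof -
    obtain x where x: "x \<in> Q" "y \<in> box x" using Q y by blast
    have "PiE I (\<lambda>i. B i (y i) \<epsilon>) \<subseteq> PiE I (\<lambda>i. B i (x i) (2 * r x))"
    proof (intro PiE_mono subsetI)
      fix i a assume i: "i \<in> I" and a: "a \<in> B i (y i) \<epsilon>"
      have "y i \<in> B i (x i) (r x)" using x(2) i unfolding box_def by blast
      then show "a \<in> B i (x i) (2 * r x)"
        using a \<epsilon>(2)[OF x(1)] tri[OF i, of "x i" "y i" a] unfolding inB[OF i] by auto
    qed
    moreover obtain U where "U \<in> \<U>" "PiE I (\<lambda>i. B i (x i) (2 * r x)) \<subseteq> U"
      using r x(1) Q(2) by (meson subsetD)
    ultimately show ?thesis by (intro bexI[of _ U]) (rule order_trans)
  qed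
  define thin where "thin i \<V> \<longleftrightarrow> finite \<V> \<and> (\<forall>V\<in>\<V>. openin (X i) V) \<and> \<Union>\<V> = topspace (X i) \<and>
     (\<forall>V\<in>\<V>. \<forall>a\<in>V. V \<subseteq> B i a \<epsilon>) \<and> (\<forall>x\<in>topspace (X i). card {V\<in>\<V>. x \<in> V} \<le> d i + 1)" for i \<V>
  have "\<exists>\<V>. thin i \<V>" if i: "i \<in> I" for i
  proof -
    have "\<And>U. U \<in> (\<lambda>x. B i x (\<epsilon>/2)) ` topspace (X i) \<Longrightarrow> openin (X i) U"
      using opB[OF i] by blast
    moreover have "topspace (X i) \<subseteq> \<Union>((\<lambda>x. B i x (\<epsilon>/2)) ` topspace (X i))"
      using \<epsilon>(1) zero[OF i] inB[OF i] by force
    ultimately obtain \<V> where \<V>: "finite \<V>" "\<forall>V\<in>\<V>. openin (X i) V" "\<Union>\<V> = topspace (X i)"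
      "\<forall>V\<in>\<V>. \<exists>U\<in>(\<lambda>x. B i x (\<epsilon>/2)) ` topspace (X i). V \<subseteq> U"
      "\<forall>x\<in>topspace (X i). card {V\<in>\<V>. x \<in> V} \<le> d i + 1"
      by (rule covering_dim_le_refine[OF dim[OF i] comp[OF i]])
    have "V \<subseteq> B i a \<epsilon>" if V: "V \<in> \<V>" and a: "a \<in> V" for V a
    proof
      fix b assume "b \<in> V"
      obtain x where x: "x \<in> topspace (X i)" "V \<subseteq> B i x (\<epsilon>/2)" using \<V>(4) V by blast
      then have "a \<in> B i x (\<epsilon>/2)" "b \<in> B i x (\<epsilon>/2)" using a \<open>b \<in> V\<close> by auto
      then show "b \<in> B i a \<epsilon>"
        using tri[OF i, of a x b] sym[OF i, of a x] unfolding inB[OF i] by auto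
    qed
    then show ?thesis using \<V> unfolding thin_def by blast
  qed
  then obtain \<V> where F: "\<And>i. i \<in> I \<Longrightarrow> thin i (\<V> i)" by metis
  have fine: "finite (\<V> i)" "\<Union>(\<V> i) = topspace (X i)" "\<And>V. V \<in> \<V> i \<Longrightarrow> openin (X i) V"
      "\<And>V a. \<lbrakk>V \<in> \<V> i; a \<in> V\<rbrakk> \<Longrightarrow> V \<subseteq> B i a \<epsilon>"
      "\<And>x. x \<in> topspace (X i) \<Longrightarrow> card {V\<in>\<V> i. x \<in> V} \<le> d i + 1" if "i \<in> I" for i
    using F[OF that] unfolding thin_def by simp_all
  have sub: "PiE I V \<subseteq> topspace ?P" if V: "V \<in> PiE I \<V>" for V
    unfolding topspace_product_topology
  proof (rule PiE_mono)
    show "V i \<subseteq> topspace (X i)" if i: "i \<in> I" for i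
      using fine(2)[OF i] PiE_mem[OF V i] by blast
  qed
  let ?\<W> = "(PiE I) ` (PiE I \<V>) - {{}}"
  show "\<exists>\<V>. finite \<V> \<and> (\<forall>V\<in>\<V>. openin ?P V) \<and> \<Union>\<V> = topspace ?P \<and> (\<forall>V\<in>\<V>. \<exists>U\<in>\<U>. V \<subseteq> U) \<and>
       (\<forall>x\<in>topspace ?P. card {V\<in>\<V>. x \<in> V} \<le> (\<Prod>i\<in>I. d i + 1) - 1 + 1)"
  proof (intro exI[of _ ?\<W>] conjI ballI)
    show "finite ?\<W>" using I fine by (intro finite_Diff finite_imageI finite_PiE) blast+
    show "openin ?P W" if "W \<in> ?\<W>" for W
      using that I fine by (auto simp: openin_PiE_gen PiE_iff)
    show "\<Union>?\<W> = topspace ?P"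
    proof
      show "\<Union>?\<W> \<subseteq> topspace ?P"
        using sub by blast
      show "topspace ?P \<subseteq> \<Union>?\<W>"
      proof
        fix x assume x: "x \<in> topspace ?P"
        then have "\<forall>i\<in>I. \<exists>V\<in>\<V> i. x i \<in> V" using fine by (fastforce simp: PiE_iff)
        then obtain V where V: "\<And>i. i \<in> I \<Longrightarrow> V i \<in> \<V> i \<and> x i \<in> V i" by metis
        then have "restrict V I \<in> PiE I \<V>" "x \<in> PiE I (restrict V I)"
          using x by (auto simp: PiE_iff)
        then show "x \<in> \<Union>?\<W>" by blast
      qed
    qed
    show "\<exists>U\<in>\<U>. W \<subseteq> U" if W: "W \<in> ?\<W>" for W
    proof -
      obtain V y where V: "V \<in> PiE I \<V>" "W = PiE I V" "y \<in> PiE I V" using W by blast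
      have "PiE I V \<subseteq> PiE I (\<lambda>i. B i (y i) \<epsilon>)"
        using V fine(4) by (intro PiE_mono) (meson PiE_mem)
      moreover have "y \<in> topspace ?P"
        using V sub by blast
      then obtain U where "U \<in> \<U>" "PiE I (\<lambda>i. B i (y i) \<epsilon>) \<subseteq> U"
        using leb by (meson bexE)
      ultimately show ?thesis unfolding V(2) by (intro bexI[of _ U]) (rule order_trans)
    qed
    show "card {W\<in>?\<W>. x \<in> W} \<le> (\<Prod>i\<in>I. d i + 1) - 1 + 1" if x: "x \<in> topspace ?P" for x
    proof -
      have "{W\<in>?\<W>. x \<in> W} \<subseteq> (PiE I) ` (PiE I (\<lambda>i. {V\<in>\<V> i. x i \<in> V}))"
        by (auto simp: PiE_iff)
      moreover have "finite (PiE I (\<lambda>i. {V\<in>\<V> i. x i \<in> V}))"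
        using I fine by (intro finite_PiE) auto
      ultimately have "card {W\<in>?\<W>. x \<in> W} \<le> card (PiE I (\<lambda>i. {V\<in>\<V> i. x i \<in> V}))"
        by (rule surj_card_le[rotated])
      also have "\<dots> = (\<Prod>i\<in>I. card {V\<in>\<V> i. x i \<in> V})" using I by (rule card_PiE)
      also have "\<dots> \<le> (\<Prod>i\<in>I. d i + 1)"
        using fine x by (intro prod_mono) (auto simp: PiE_iff)
      finally show ?thesis by simp
    qed
  qed
qed

section \<open>The countable sum theorem in dimension zero\<close>

text \<open>
  This is \<open>Ind X \<le> 0\<close> for the large inductive dimension. For compact Hausdorff spaces it agrees
  with covering dimension \<open>0\<close>, and a separation can be built up one closed piece at a time.
\<close>

definition clopen_separated :: "'a topology \<Rightarrow> bool" where
  "clopen_separated X \<longleftrightarrow>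
     (\<forall>A B. closedin X A \<and> closedin X B \<and> disjnt A B \<longrightarrow>
        (\<exists>C. openin X C \<and> closedin X C \<and> A \<subseteq> C \<and> disjnt C B))"

lemma clopen_separatedE:
  assumes "clopen_separated X" "closedin X A" "closedin X B" "disjnt A B"
  obtains C where "openin X C" "closedin X C" "A \<subseteq> C" "disjnt C B"
proof -
  have "\<exists>C. openin X C \<and> closedin X C \<and> A \<subseteq> C \<and> disjnt C B"
    using assms unfolding clopen_separated_def by simp
  then show thesis by (elim exE conjE) (rule that)
qed

lemma clopen_separated_if_dim_0:
  assumes "covering_dim_le X 0"
  shows "clopen_separated X"
  unfolding clopen_separated_def
proof (intro allI impI, elim conjE)
  fix A B assume AB: "closedin X A" "closedin X B" "disjnt A B"
  let ?\<U> = "{topspace X - A, topspace X - B}"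
  have fin: "finite ?\<U>" and op: "\<forall>U\<in>?\<U>. openin X U" using AB by auto
  have un: "\<Union>?\<U> = topspace X" using AB unfolding disjnt_def by blast
  obtain \<V> where \<V>: "finite \<V>" "\<forall>V\<in>\<V>. openin X V" "\<Union>\<V> = topspace X"
    "\<forall>V\<in>\<V>. \<exists>U\<in>?\<U>. V \<subseteq> U" "\<forall>x\<in>topspace X. card {V\<in>\<V>. x \<in> V} \<le> 0 + 1"
    by (rule covering_dim_leE[OF assms fin op un])
  have disj: "V = W" if "V \<in> \<V>" "W \<in> \<V>" "x \<in> V" "x \<in> W" for V W x
  proof -
    have "x \<in> topspace X" using that(1,3) \<V>(3) by blast
    then have "card {V\<in>\<V>. x \<in> V} \<le> 1" using \<V>(5) by simp
    then show ?thesis using that \<V>(1) card_le_Suc0_iff_eq[of "{V\<in>\<V>. x \<in> V}"] by auto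
  qed
  define C where "C = \<Union>{V\<in>\<V>. V \<inter> A \<noteq> {}}"
  define C' where "C' = \<Union>{V\<in>\<V>. V \<inter> A = {}}"
  have "openin X C" "openin X C'" unfolding C_def C'_def using \<V>(2) by (auto intro!: openin_Union)
  moreover have "C' = topspace X - C"
  proof
    show "C' \<subseteq> topspace X - C"
    proof
      fix x assume "x \<in> C'"
      then obtain V where V: "V \<in> \<V>" "V \<inter> A = {}" "x \<in> V" unfolding C'_def by blast
      have "x \<notin> W" if "W \<in> \<V>" "W \<inter> A \<noteq> {}" for W
        using disj[OF V(1) that(1) V(3)] V(2) that(2) by blast
      then show "x \<in> topspace X - C" using V \<V>(3) unfolding C_def by blast
    qed
    show "topspace X - C \<subseteq> C'"
    proof
      fix x assume x: "x \<in> topspace X - C"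
      then obtain V where "V \<in> \<V>" "x \<in> V" using \<V>(3) by blast
      then show "x \<in> C'" using x unfolding C_def C'_def by blast
    qed
  qed
  ultimately have "closedin X C"
    using openin_subset by (metis closedin_def)
  moreover have "A \<subseteq> C"
  proof
    fix x assume "x \<in> A"
    moreover from this obtain V where "V \<in> \<V>" "x \<in> V"
      using closedin_subset[OF AB(1)] \<V>(3) by blast
    ultimately show "x \<in> C" unfolding C_def by blast
  qed
  moreover have "disjnt C B"
  proof -
    have "V \<inter> B = {}" if "V \<in> \<V>" "V \<inter> A \<noteq> {}" for V
      using \<V>(4) that by blast
    then show ?thesis unfolding C_def disjnt_def by blast
  qed
  ultimately show "\<exists>C. openin X C \<and> closedin X C \<and> A \<subseteq> C \<and> disjnt C B"
    using \<open>openin X C\<close> by blast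
qed

text \<open>
  Every point has a clopen neighbourhood inside a member of the given cover. A finite subcover by
  clopen sets becomes disjoint when each member loses the union of the earlier ones.
\<close>

lemma dim_0_if_clopen_separated:
  assumes comp: "compact_space X" and "Hausdorff_space X" and sep: "clopen_separated X"
  shows "covering_dim_le X 0"
  unfolding covering_dim_le_def
proof (intro allI impI, elim conjE)
  fix \<U> assume \<U>: "finite \<U>" "\<forall>U\<in>\<U>. openin X U" "\<Union>\<U> = topspace X"
  let ?\<K> = "{C. openin X C \<and> closedin X C \<and> (\<exists>U\<in>\<U>. C \<subseteq> U)}"
  have "topspace X \<subseteq> \<Union>?\<K>"
  proof
    fix x assume x: "x \<in> topspace X"
    then obtain U where U: "U \<in> \<U>" "x \<in> U" using \<U>(3) by blast
    have "closedin X {x}" "closedin X (topspace X - U)" "disjnt {x} (topspace X - U)"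
      using x U \<U>(2) assms(2) by (auto simp: closedin_Hausdorff_singleton)
    then obtain C where C: "openin X C" "closedin X C" "{x} \<subseteq> C" "disjnt C (topspace X - U)"
      by (rule clopen_separatedE[OF sep])
    moreover have "C \<subseteq> U"
      using C(4) openin_subset[OF C(1)] unfolding disjnt_def by blast
    ultimately show "x \<in> \<Union>?\<K>" using U by blast
  qed
  then obtain \<F> where \<F>: "finite \<F>" "\<F> \<subseteq> ?\<K>" "topspace X \<subseteq> \<Union>\<F>"
    by (rule compact_space_finite_subcover[OF comp, rotated]) simp_all
  then obtain F :: "nat \<Rightarrow> 'a set" and m where F: "\<F> = F ` {..<m}"
    by (metis finite_imp_nat_seg_image_inj_on lessThan_def)
  define G where "G i = F i - \<Union>(F ` {..<i})" for i
  have Fi: "openin X (F i)" "closedin X (F i)" "\<exists>U\<in>\<U>. F i \<subseteq> U" if "i < m" for i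
    using \<F>(2) that unfolding F by auto
  have op: "openin X (G i)" if "i < m" for i
    unfolding G_def using that Fi by (intro openin_diff closedin_Union) auto
  have ex: "\<exists>i<m. x \<in> G i" if "x \<in> topspace X" for x
  proof -
    have ex: "\<exists>i. i < m \<and> x \<in> F i" using that \<F>(3) unfolding F by blast
    define i where "i = (LEAST i. i < m \<and> x \<in> F i)"
    have "i < m \<and> x \<in> F i" unfolding i_def using ex by (rule LeastI_ex)
    moreover have "x \<notin> F j" if "j < i" for j
      using not_less_Least[of j "\<lambda>i. i < m \<and> x \<in> F i"] that calculation unfolding i_def by simp
    ultimately show ?thesis unfolding G_def by blast
  qed
  have uniq: "i = j" if "x \<in> G i" "x \<in> G j" for i j x
    using that unfolding G_def by (metis DiffE UN_I lessThan_iff linorder_neqE_nat)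
  have "\<Union>(G ` {..<m}) = topspace X"
  proof
    show "\<Union>(G ` {..<m}) \<subseteq> topspace X" using openin_subset[OF op] by auto
    show "topspace X \<subseteq> \<Union>(G ` {..<m})" using ex by auto
  qed
  moreover have "card {V \<in> G ` {..<m}. x \<in> V} \<le> 0 + 1" for x
  proof -
    have "\<forall>V\<in>{V \<in> G ` {..<m}. x \<in> V}. \<forall>W\<in>{V \<in> G ` {..<m}. x \<in> V}. V = W"
      using uniq by blast
    then show ?thesis by (simp add: card_le_Suc0_iff_eq)
  qed
  moreover have "\<exists>U\<in>\<U>. G i \<subseteq> U" if "i < m" for i
    using Fi(3)[OF that] unfolding G_def by blast
  ultimately show "\<exists>\<V>. finite \<V> \<and> (\<forall>V\<in>\<V>. openin X V) \<and> \<Union>\<V> = topspace X \<and>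
          (\<forall>V\<in>\<V>. \<exists>U\<in>\<U>. V \<subseteq> U) \<and> (\<forall>x\<in>topspace X. card {V\<in>\<V>. x \<in> V} \<le> 0 + 1)"
    using op by (intro exI[of _ "G ` {..<m}"]) simp
qed

text \<open>
  The inductive step of the sum theorem: a clopen separation inside the closed piece \<open>Z\<close> is
  thickened to disjoint open sets of \<open>X\<close>, leaving room between their closures to go on.
\<close>

lemma extend_separation_over_closed_piece:
  assumes norm: "normal_space X" and Z: "closedin X Z" and sep: "clopen_separated (subtopology X Z)"
    and AB: "closedin X A" "closedin X B" "disjnt A B"
  obtains A' B' where "closedin X A'" "closedin X B'" "disjnt A' B'"
    "A \<subseteq> X interior_of A'" "B \<subseteq> X interior_of B'" "Z \<subseteq> A' \<union> B'"
proof -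
  have "closedin (subtopology X Z) (A \<inter> Z)" "closedin (subtopology X Z) (B \<inter> Z)"
    using AB unfolding closedin_subtopology by blast+
  moreover have "disjnt (A \<inter> Z) (B \<inter> Z)" using AB(3) unfolding disjnt_def by blast
  ultimately obtain C where C: "openin (subtopology X Z) C" "closedin (subtopology X Z) C"
      "A \<inter> Z \<subseteq> C" "disjnt C (B \<inter> Z)"
    by (rule clopen_separatedE[OF sep])
  have cC: "closedin X C" using C(2) Z closedin_closed_subtopology by blast
  have CZ: "C \<subseteq> Z" using C(2) Z closedin_closed_subtopology by blast
  have "topspace (subtopology X Z) = Z" using closedin_subset[OF Z] by auto
  then have "closedin (subtopology X Z) (Z - C)" using C(1) by (metis closedin_diff closedin_topspace)
  then have cD: "closedin X (Z - C)" using Z closedin_closed_subtopology by blast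
  let ?A = "A \<union> C" and ?B = "B \<union> (Z - C)"
  have cl: "closedin X ?A" "closedin X ?B" using AB cC cD by auto
  have "disjnt ?A ?B" using AB(3) C(3,4) CZ unfolding disjnt_def by blast
  then have *: "closedin X ?A \<and> openin X (topspace X - ?B) \<and> ?A \<subseteq> topspace X - ?B"
    using cl closedin_subset[OF cl(1)] unfolding disjnt_def by blast
  obtain U where U: "openin X U" "?A \<subseteq> U" "X closure_of U \<subseteq> topspace X - ?B"
    using norm[unfolded normal_space_alt, rule_format, OF *] by blast
  then have *: "closedin X ?B \<and> openin X (topspace X - X closure_of U) \<and> ?B \<subseteq> topspace X - X closure_of U"
    using cl(2) closedin_subset[OF cl(2)] closedin_closure_of[of X U] by blast
  obtain V where V: "openin X V" "?B \<subseteq> V" "X closure_of V \<subseteq> topspace X - X closure_of U"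
    using norm[unfolded normal_space_alt, rule_format, OF *] by blast
  have UV: "openin X U" "openin X V" "?A \<subseteq> U" "?B \<subseteq> V" "disjnt (X closure_of U) (X closure_of V)"
    using U V unfolding disjnt_def by blast+
  have cl: "U \<subseteq> X closure_of U" "V \<subseteq> X closure_of V"
    using UV(1,2) by (simp_all add: closure_of_subset openin_subset)
  then have "U \<subseteq> X interior_of (X closure_of U)" "V \<subseteq> X interior_of (X closure_of V)"
    using UV(1,2) by (simp_all add: interior_of_maximal)
  moreover have "Z \<subseteq> X closure_of U \<union> X closure_of V"
    using cl UV(3,4) by blast
  ultimately show thesis
    using UV CZ by (intro that[of "X closure_of U" "X closure_of V"]) auto
qed

text \<open>
  Starting from two disjoint closed sets, the pieces are absorbed one after the other. Each pair of
  closed sets lies in the interior of the next pair, so the two unions are open; they are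
  disjoint and together exhaust the space, hence clopen.
\<close>

lemma clopen_separated_countable_sum:
  fixes Z :: "nat \<Rightarrow> 'a set"
  assumes norm: "normal_space X" and cl: "\<And>i. closedin X (Z i)"
    and sep: "\<And>i. clopen_separated (subtopology X (Z i))" and un: "topspace X \<subseteq> (\<Union>i. Z i)"
  shows "clopen_separated X"
  unfolding clopen_separated_def
proof (intro allI impI, elim conjE)
  fix A B assume AB: "closedin X A" "closedin X B" "disjnt A B"
  define ok where "ok = (\<lambda>p. closedin X (fst p) \<and> closedin X (snd p) \<and> disjnt (fst p) (snd p))"
  define nxt where "nxt = (\<lambda>i p q. fst p \<subseteq> X interior_of fst q \<and> snd p \<subseteq> X interior_of snd q \<and>
      Z i \<subseteq> fst q \<union> snd q)"
  have "\<exists>s. \<forall>n. (ok (s n) \<and> (n = 0 \<longrightarrow> s n = (A, B))) \<and> nxt n (s n) (s (Suc n))"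
  proof (rule dependent_nat_choice)
    show "\<exists>p. ok p \<and> (0 = 0 \<longrightarrow> p = (A, B))" using AB unfolding ok_def by auto
  next
    fix p n assume "ok p \<and> (n = (0::nat) \<longrightarrow> p = (A, B))"
    then have p: "closedin X (fst p)" "closedin X (snd p)" "disjnt (fst p) (snd p)"
      unfolding ok_def by auto
    obtain A' B' where "closedin X A'" "closedin X B'" "disjnt A' B'"
      "fst p \<subseteq> X interior_of A'" "snd p \<subseteq> X interior_of B'" "Z n \<subseteq> A' \<union> B'"
      by (rule extend_separation_over_closed_piece[OF norm cl sep p])
    then show "\<exists>q. (ok q \<and> (Suc n = 0 \<longrightarrow> q = (A, B))) \<and> nxt n p q"
      unfolding ok_def nxt_def by (intro exI[of _ "(A', B')"]) auto
  qed
  then obtain s where s: "\<And>n. ok (s n)" "s 0 = (A, B)" "\<And>n. nxt n (s n) (s (Suc n))"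
    by blast
  define L R where "L n = fst (s n)" and "R n = snd (s n)" for n
  have step: "L n \<subseteq> X interior_of L (Suc n)" "R n \<subseteq> X interior_of R (Suc n)"
      "Z n \<subseteq> L (Suc n) \<union> R (Suc n)" "disjnt (L n) (R n)" for n
    using s(1)[of n] s(3)[of n] unfolding L_def R_def ok_def nxt_def by auto
  have mono: "mono L" "mono R"
    using step(1,2) interior_of_subset by (force simp: mono_iff_le_Suc)+
  define U V where "U = (\<Union>n. X interior_of L n)" and "V = (\<Union>n. X interior_of R n)"
  have LU: "L n \<subseteq> U" "R n \<subseteq> V" for n
    using step(1,2)[of n] unfolding U_def V_def by blast+
  have opUV: "openin X U" "openin X V" unfolding U_def V_def by auto
  have disj: "U \<inter> V = {}"
  proof (rule ccontr)
    assume "U \<inter> V \<noteq> {}"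
    then obtain x i j where "x \<in> X interior_of L i" "x \<in> X interior_of R j"
      unfolding U_def V_def by blast
    then have "x \<in> L i" "x \<in> R j" using interior_of_subset by fast+
    then have "x \<in> L (max i j)" "x \<in> R (max i j)"
      using monoD[OF mono(1), of i "max i j"] monoD[OF mono(2), of j "max i j"] by auto
    then show False using step(4) unfolding disjnt_def by blast
  qed
  have all: "topspace X \<subseteq> U \<union> V"
    using un step(3) LU by blast
  have "topspace X - V = U" using disj all openin_subset[OF opUV(1)] by blast
  then have "closedin X U" using opUV(2) by (metis closedin_diff closedin_topspace)
  moreover have "A \<subseteq> U" "B \<subseteq> V" using LU[of 0] s(2) unfolding L_def R_def by auto
  ultimately show "\<exists>C. openin X C \<and> closedin X C \<and> A \<subseteq> C \<and> disjnt C B"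
    using opUV disj unfolding disjnt_def by (intro exI[of _ U]) blast
qed

lemma dim_0_countable_sum:
  fixes Z :: "nat \<Rightarrow> 'a set"
  assumes "compact_space X" "Hausdorff_space X" and "\<And>i. closedin X (Z i)"
    and "\<And>i. covering_dim_le (subtopology X (Z i)) 0" and "topspace X \<subseteq> (\<Union>i. Z i)"
  shows "covering_dim_le X 0"
proof (rule dim_0_if_clopen_separated[OF assms(1,2)])
  have "normal_space X"
    using assms(1,2) by (simp add: compact_Hausdorff_or_regular_imp_normal_space)
  then show "clopen_separated X"
    by (rule clopen_separated_countable_sum[OF _ assms(3) clopen_separated_if_dim_0[OF assms(4)] assms(5)])
qed

section \<open>Pseudocompact spaces with a coarser metrizable topology\<close>

definition pseudocompact_space :: "'a topology \<Rightarrow> bool" where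
  "pseudocompact_space X \<longleftrightarrow>
     (\<forall>f. continuous_map X euclideanreal f \<longrightarrow> (\<exists>b. \<forall>x\<in>topspace X. \<bar>f x\<bar> \<le> b))"

text \<open>
  If the image of a closed set \<open>A\<close> had a limit point \<open>p\<close> outside it, then \<open>1 / d (f y) p\<close> would be
  unbounded on \<open>A\<close>. It may be undefined at one point, the preimage of \<open>p\<close>; adding to the
  denominator a function that vanishes on \<open>A\<close> and is positive at that point makes it continuous.
\<close>

lemma closed_map_if_pseudocompact:
  assumes Y: "completely_regular_space Y" "pseudocompact_space Y" and M: "metrizable_space M"
    and f: "continuous_map Y M f" "inj_on f (topspace Y)"
  shows "closed_map Y M f"
  unfolding closed_map_def
proof (intro allI impI)
  fix A assume A: "closedin Y A"
  obtain N d where Nd: "Metric_space N d" and Meq: "M = Metric_space.mtopology N d"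
    using M unfolding metrizable_space_def by blast
  interpret Metric_space N d by (rule Nd)
  have AY: "A \<subseteq> topspace Y" using A by (rule closedin_subset)
  have fN: "f y \<in> N" if "y \<in> topspace Y" for y
    using f(1) that unfolding Meq by (auto simp: continuous_map_def)
  have "p \<in> f ` A" if p: "p \<in> mtopology closure_of (f ` A)" for p
  proof (rule ccontr)
    assume pA: "p \<notin> f ` A"
    have pN: "p \<in> N" and near: "\<And>r. r > 0 \<Longrightarrow> \<exists>y\<in>A. d p (f y) < r"
      using p unfolding metric_closure_of by auto
    have "\<exists>k. continuous_map Y euclideanreal k \<and> (\<forall>y\<in>topspace Y. k y \<le> 1) \<and> (\<forall>y\<in>A. k y = 1) \<and>
        (\<forall>y\<in>topspace Y. f y = p \<longrightarrow> k y = 0)"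
    proof (cases "p \<in> f ` topspace Y")
      case True
      then obtain y0 where y0: "y0 \<in> topspace Y - A" "f y0 = p" using pA by blast
      then obtain k :: "'a \<Rightarrow> real" where k: "continuous_map Y (top_of_set {0..1}) k" "k y0 = 0" "k ` A \<subseteq> {1}"
        using Y(1) A unfolding completely_regular_space_def by blast
      have "\<forall>y\<in>topspace Y. f y = p \<longrightarrow> k y = 0"
        using f(2) y0 k(2) by (metis Diff_iff inj_onD)
      moreover have "continuous_map Y euclideanreal k" "\<forall>y\<in>topspace Y. k y \<le> 1"
        using k(1) by (auto simp: continuous_map_in_subtopology)
      ultimately show ?thesis using k(3) by blast
    next
      case False
      then show ?thesis by (intro exI[of _ "\<lambda>_. 1"]) auto
    qed
    then obtain k where k: "continuous_map Y euclideanreal k" "\<forall>y\<in>topspace Y. k y \<le> 1"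
        "\<forall>y\<in>A. k y = 1" "\<forall>y\<in>topspace Y. f y = p \<longrightarrow> k y = 0"
      by (elim exE conjE)
    define h where "h y = 1 / (d p (f y) + (1 - k y))" for y
    have pos: "d p (f y) + (1 - k y) \<noteq> 0" if y: "y \<in> topspace Y" for y
    proof (cases "f y = p")
      case True
      then show ?thesis using k(4) y pN by simp
    next
      case False
      then have "d p (f y) > 0" using mdist_pos_less[of p "f y"] pN fN[OF y] by auto
      then show ?thesis using k(2) y by fastforce
    qed
    have "continuous_map Y euclideanreal (\<lambda>y. d p (f y))"
      using f(1) pN continuous_map_mdist[of Y "metric (N, d)" "\<lambda>_. p" f]
      unfolding Meq by (simp add: mtopology_of)
    then have "continuous_map Y euclideanreal h"
      unfolding h_def using k(1) pos by (intro continuous_intros) auto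
    then obtain b where b: "\<And>y. y \<in> topspace Y \<Longrightarrow> \<bar>h y\<bar> \<le> b"
      using Y(2) unfolding pseudocompact_space_def by blast
    have "0 < 1 / (\<bar>b\<bar> + 1)" by (simp add: add_nonneg_pos)
    then obtain y where y: "y \<in> A" "d p (f y) < 1 / (\<bar>b\<bar> + 1)" using near by blast
    have "d p (f y) > 0" using mdist_pos_less[of p "f y"] pN fN y(1) AY pA by blast
    then have "h y > \<bar>b\<bar> + 1"
      using y k(3) unfolding h_def by (simp add: field_simps)
    then show False using b[of y] y(1) AY by auto
  qed
  moreover have "f ` A \<subseteq> topspace mtopology" using AY fN by auto
  ultimately show "closedin M (f ` A)"
    unfolding Meq closure_of_subset_eq[symmetric] by blast
qed

text \<open>
  The family \<open>G\<close> defines an injective continuous map into \<open>\<real>\<^sup>\<omega>\<close>. It is a closed map, so it is an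
  embedding onto a closed set, and the image lies in a compact box because each \<open>G n\<close> is bounded.
\<close>

lemma compact_metrizable_if_pseudocompact:
  fixes G :: "nat \<Rightarrow> 'a \<Rightarrow> real"
  assumes Y: "completely_regular_space Y" "pseudocompact_space Y"
    and G: "\<And>n. continuous_map Y euclideanreal (G n)"
    and sep: "\<And>y z. \<lbrakk>y \<in> topspace Y; z \<in> topspace Y; y \<noteq> z\<rbrakk> \<Longrightarrow> \<exists>n. G n y \<noteq> G n z"
  shows "compact_space Y \<and> metrizable_space Y"
proof -
  define M where "M = product_topology (\<lambda>_::nat. euclideanreal) UNIV"
  define f where "f y n = G n y" for y n
  have M: "metrizable_space M"
    unfolding M_def by (simp add: metrizable_space_product_topology metrizable_space_euclidean)
  have cf: "continuous_map Y M f"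
    unfolding M_def continuous_map_componentwise_UNIV f_def by (simp add: G)
  have inj: "inj_on f (topspace Y)"
  proof (rule inj_onI, rule ccontr)
    fix y z assume "y \<in> topspace Y" "z \<in> topspace Y" "f y = f z" "y \<noteq> z"
    then show False using sep[of y z] unfolding f_def by metis
  qed
  have cl: "closed_map Y M f" by (rule closed_map_if_pseudocompact[OF Y M cf inj])
  have "embedding_map Y M f" using cf cl inj by (rule injective_closed_imp_embedding_map)
  then have hom: "Y homeomorphic_space subtopology M (f ` topspace Y)"
    by (rule embedding_map_imp_homeomorphic_space)
  have "\<exists>b. \<forall>y\<in>topspace Y. \<bar>G n y\<bar> \<le> b" for n
    using Y(2) G unfolding pseudocompact_space_def by blast
  then obtain b where b: "\<And>n y. y \<in> topspace Y \<Longrightarrow> \<bar>G n y\<bar> \<le> b n" by metis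
  have "compactin M (PiE UNIV (\<lambda>n. {- b n..b n}))"
    unfolding M_def by (simp add: compactin_PiE)
  moreover have "f ` topspace Y \<subseteq> PiE UNIV (\<lambda>n. {- b n..b n})"
    using b unfolding f_def by (force simp: abs_le_iff)
  moreover have "closedin M (f ` topspace Y)"
    using cl unfolding closed_map_def by simp
  ultimately have "compactin M (f ` topspace Y)" by (rule closed_compactin)
  then have "compact_space (subtopology M (f ` topspace Y))" by (rule compact_space_subtopology)
  then show ?thesis
    using hom M metrizable_space_subtopology homeomorphic_compact_space homeomorphic_metrizable_space
    by metis
qed

section \<open>Countable networks\<close>

lemma countable_closed_network:
  assumes "compact_space X" "metrizable_space X"
  obtains \<C> where "countable \<C>" "\<forall>C\<in>\<C>. closedin X C"
    "\<forall>U x. openin X U \<and> x \<in> U \<longrightarrow> (\<exists>C\<in>\<C>. x \<in> C \<and> C \<subseteq> U)"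
proof -
  obtain M d where Md: "Metric_space M d" and Xeq: "X = Metric_space.mtopology M d"
    using assms(2) unfolding metrizable_space_def by blast
  interpret Metric_space M d by (rule Md)
  have "\<exists>F. finite F \<and> F \<subseteq> M \<and> M \<subseteq> (\<Union>c\<in>F. mball c (1 / Suc n))" for n
  proof -
    have "compact_space mtopology" using assms(1) Xeq by simp
    then obtain \<F> where "finite \<F>" "\<F> \<subseteq> (\<lambda>c. mball c (1 / Suc n)) ` M" "topspace mtopology \<subseteq> \<Union>\<F>"
      by (rule compact_space_finite_subcover[where \<U> = "(\<lambda>c. mball c (1 / Suc n)) ` M"]) auto
    then show ?thesis by (metis finite_subset_image topspace_mtopology)
  qed
  then obtain F where F: "\<And>n. finite (F n)" "\<And>n. F n \<subseteq> M" "\<And>n. M \<subseteq> (\<Union>c\<in>F n. mball c (1 / Suc n))"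
    by metis
  define \<C> where "\<C> = (\<Union>n. (\<lambda>c. mcball c (1 / Suc n)) ` F n)"
  show thesis
  proof
    show "countable \<C>" unfolding \<C>_def using F(1) by (auto intro: countable_finite)
    show "\<forall>C\<in>\<C>. closedin X C"
      unfolding \<C>_def Xeq by auto
    have "\<exists>C\<in>\<C>. x \<in> C \<and> C \<subseteq> U" if U: "openin X U" "x \<in> U" for U x
    proof -
      obtain r where r: "r > 0" "mball x r \<subseteq> U" "x \<in> M"
        using U unfolding Xeq openin_mtopology by blast
      obtain n where n: "1 / Suc n < r / 2" using r(1) by (meson half_gt_zero nat_approx_posE)
      obtain c where c: "c \<in> F n" "x \<in> mball c (1 / Suc n)" using F(3) r(3) by blast
      have "mcball c (1 / Suc n) \<subseteq> mball x r"
      proof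
        fix z assume "z \<in> mcball c (1 / Suc n)"
        then show "z \<in> mball x r"
          using c n triangle[of x c z] commute[of x c] by auto
      qed
      moreover have "x \<in> mcball c (1 / Suc n)" using c(2) by auto
      moreover have "mcball c (1 / Suc n) \<in> \<C>" using c(1) unfolding \<C>_def by blast
      ultimately show ?thesis using r(2) by (intro bexI[of _ "mcball c (1 / Suc n)"]) auto
    qed
    then show "\<forall>U x. openin X U \<and> x \<in> U \<longrightarrow> (\<exists>C\<in>\<C>. x \<in> C \<and> C \<subseteq> U)" by simp
  qed
qed

section \<open>The space of continuous functions\<close>

lemma topspace_Cp_iff:
  "f \<in> topspace (Cp X) \<longleftrightarrow> f \<in> extensional (topspace X) \<and> continuous_map X euclideanreal f"
  unfolding Cp_def by (auto simp: PiE_def)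

lemma restrict_in_topspace_Cp:
  assumes "continuous_map X euclideanreal f"
  shows "restrict f (topspace X) \<in> topspace (Cp X)"
  unfolding topspace_Cp_iff using assms by (auto intro: continuous_map_eq)

lemma bounded_if_continuous_on_compact:
  assumes "compact_space X" "f \<in> topspace (Cp X)"
  obtains b where "\<And>x. x \<in> topspace X \<Longrightarrow> \<bar>f x\<bar> \<le> b"
proof -
  have "compactin euclideanreal (f ` topspace X)"
    using assms unfolding topspace_Cp_iff compact_space_def by (blast intro: image_compactin)
  then have "bounded (f ` topspace X)" by (simp add: compact_imp_bounded)
  then show thesis unfolding bounded_iff using that by auto
qed

text \<open>
  A condition says that \<open>f\<close> maps a given member of a countable network into a given rational
  interval. For each finite set of conditions that some continuous function satisfies, one such
  function is put into the dense set.
\<close>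

lemma Cp_separable:
  assumes "compact_space X" "metrizable_space X"
  obtains D where "countable D" "D \<subseteq> topspace (Cp X)"
    "\<And>f K e. \<lbrakk>f \<in> topspace (Cp X); finite K; K \<subseteq> topspace X; e > 0\<rbrakk> \<Longrightarrow> \<exists>g\<in>D. \<forall>x\<in>K. \<bar>g x - f x\<bar> < e"
proof -
  obtain \<C> where \<C>: "countable \<C>"
      "\<forall>U x. openin X U \<and> x \<in> U \<longrightarrow> (\<exists>C\<in>\<C>. x \<in> C \<and> C \<subseteq> U)"
    using countable_closed_network[OF assms] by metis
  define P where "P S = {f \<in> topspace (Cp X). \<forall>(C, r, n)\<in>S. \<forall>x\<in>C. \<bar>f x - r\<bar> < 1 / Suc n}"
    for S :: "('a set \<times> real \<times> nat) set"
  let ?\<S> = "{S. finite S \<and> S \<subseteq> \<C> \<times> \<rat> \<times> (UNIV::nat set)}"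
  define D where "D = (\<lambda>S. SOME f. f \<in> P S) ` {S\<in>?\<S>. P S \<noteq> {}}"
  have some: "(SOME f. f \<in> P S) \<in> P S" if "P S \<noteq> {}" for S
    using that by (simp add: some_in_eq)
  show thesis
  proof
    have "countable ?\<S>"
      using \<C>(1) by (intro countable_Collect_finite_subset countable_SIGMA) (auto simp: countable_rat)
    then have "countable {S\<in>?\<S>. P S \<noteq> {}}"
      by (rule countable_subset[rotated]) blast
    then show "countable D" unfolding D_def by simp
    show "D \<subseteq> topspace (Cp X)" using some unfolding D_def P_def by blast
    fix f K and e :: real assume f: "f \<in> topspace (Cp X)" and K: "finite K" "K \<subseteq> topspace X" and e: "e > 0"
    obtain n where n: "1 / Suc n < e / 2" using e by (meson half_gt_zero nat_approx_posE)
    have "\<exists>C r. C \<in> \<C> \<and> x \<in> C \<and> r \<in> \<rat> \<and> (\<forall>z\<in>C. \<bar>f z - r\<bar> < 1 / Suc n)" if x: "x \<in> K" for x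
    proof -
      obtain r where r: "r \<in> \<rat>" "f x - 1 / Suc n < r" "r < f x + 1 / Suc n"
        using Rats_dense_in_real[of "f x - 1 / Suc n" "f x + 1 / Suc n"] by auto
      have "openin X {z \<in> topspace X. f z \<in> {r - 1 / Suc n<..<r + 1 / Suc n}}"
        using f unfolding topspace_Cp_iff by (intro openin_continuous_map_preimage[where Y = euclideanreal]) auto
      moreover have "x \<in> {z \<in> topspace X. f z \<in> {r - 1 / Suc n<..<r + 1 / Suc n}}"
        using x K(2) r by auto
      ultimately obtain C where "C \<in> \<C>" "x \<in> C" "C \<subseteq> {z \<in> topspace X. f z \<in> {r - 1 / Suc n<..<r + 1 / Suc n}}"
        using \<C>(2) by blast
      moreover from this(3) have "\<forall>z\<in>C. \<bar>f z - r\<bar> < 1 / Suc n" by (auto simp: abs_less_iff)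
      ultimately show ?thesis using r(1) by blast
    qed
    then obtain C r where Cr: "\<And>x. x \<in> K \<Longrightarrow> C x \<in> \<C> \<and> x \<in> C x \<and> r x \<in> \<rat> \<and> (\<forall>z\<in>C x. \<bar>f z - r x\<bar> < 1 / Suc n)"
      by metis
    define S where "S = (\<lambda>x. (C x, r x, n)) ` K"
    have "f \<in> P S" using f Cr unfolding P_def S_def by auto
    then have ne: "P S \<noteq> {}" by blast
    define g where "g = (SOME f. f \<in> P S)"
    have gP: "g \<in> P S" unfolding g_def by (rule some[OF ne])
    have "S \<in> ?\<S>" using K(1) Cr unfolding S_def by auto
    then have "g \<in> D" using ne unfolding D_def g_def by blast
    moreover have "\<bar>g x - f x\<bar> < e" if x: "x \<in> K" for x
    proof -
      have "\<bar>g x - r x\<bar> < 1 / Suc n" using gP x Cr[OF x] unfolding P_def S_def by blast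
      moreover have "\<bar>f x - r x\<bar> < 1 / Suc n" using Cr[OF x] by blast
      ultimately show ?thesis using n by linarith
    qed
    ultimately show "\<exists>g\<in>D. \<forall>x\<in>K. \<bar>g x - f x\<bar> < e" by blast
  qed
qed

lemma ball_in_open_set_Cp:
  assumes "openin (Cp X) V" "f \<in> V"
  obtains K \<delta> where "finite K" "K \<subseteq> topspace X" "\<delta> > 0"
    "\<forall>g\<in>topspace (Cp X). (\<forall>x\<in>K. \<bar>g x - f x\<bar> < \<delta>) \<longrightarrow> g \<in> V"
proof -
  obtain W where W: "openin (product_topology (\<lambda>_. euclideanreal) (topspace X)) W"
      "V = W \<inter> {f. continuous_map X euclideanreal f}"
    using assms(1) unfolding Cp_def openin_subtopology by blast
  then have "f \<in> W" using assms(2) by blast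
  then obtain U where U: "finite {i \<in> topspace X. U i \<noteq> topspace (euclidean :: real topology)}"
      "\<forall>i\<in>topspace X. openin (euclidean :: real topology) (U i)"
      "f \<in> PiE (topspace X) U" "PiE (topspace X) U \<subseteq> W"
    using W(1) unfolding openin_product_topology_alt by meson
  define K where "K = {i \<in> topspace X. U i \<noteq> UNIV}"
  have "\<exists>e>0. ball (f x) e \<subseteq> U x" if "x \<in> K" for x
  proof -
    have "open (U x)" "f x \<in> U x" using U(2,3) that unfolding K_def by auto
    then show ?thesis by (simp add: open_contains_ball)
  qed
  then obtain e where e: "\<And>x. x \<in> K \<Longrightarrow> e x > 0 \<and> ball (f x) (e x) \<subseteq> U x" by metis
  have fin: "finite K" using U(1) unfolding K_def by simp
  define \<delta> where "\<delta> = Min (insert 1 (e ` K))"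
  have \<delta>: "\<delta> > 0" "\<And>x. x \<in> K \<Longrightarrow> \<delta> \<le> e x" unfolding \<delta>_def using fin e by auto
  have "g \<in> V" if g: "g \<in> topspace (Cp X)" "\<forall>x\<in>K. \<bar>g x - f x\<bar> < \<delta>" for g
  proof -
    have "g x \<in> U x" if x: "x \<in> topspace X" for x
    proof (cases "x \<in> K")
      case True
      then have "g x \<in> ball (f x) (e x)" using g(2) \<delta>(2)[OF True] by (auto simp: dist_real_def abs_minus_commute)
      then show ?thesis using e True by blast
    next
      case False
      then show ?thesis using x unfolding K_def by auto
    qed
    then have "g \<in> PiE (topspace X) U" using g(1) unfolding topspace_Cp_iff by (auto simp: PiE_iff)
    then show ?thesis using U(4) W(2) g(1) unfolding topspace_Cp_iff by blast
  qed
  then show thesis using fin \<delta>(1) unfolding K_def by (intro that[of K \<delta>]) (auto simp: K_def)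
qed

lemma finite_interpolation:
  assumes "normal_space X" "Hausdorff_space X"
    and K: "finite K" "K \<subseteq> topspace X" "finite L" "L \<subseteq> topspace X" "K \<inter> L = {}"
    and fg: "f \<in> topspace (Cp X)" "g \<in> topspace (Cp X)"
  obtains h where "h \<in> topspace (Cp X)" "\<forall>x\<in>K. h x = f x" "\<forall>x\<in>L. h x = g x"
proof -
  have "closedin X K" "closedin X L" using K assms(2) by (auto intro: closedin_Hausdorff_finite)
  moreover have "disjnt K L" using K(5) unfolding disjnt_def .
  ultimately obtain u where u: "continuous_map X euclideanreal u" "u ` K \<subseteq> {0::real}" "u ` L \<subseteq> {1}"
    using Urysohn_lemma_alt[OF assms(1)] by metis
  define h where "h = restrict (\<lambda>x. f x * (1 - u x) + g x * u x) (topspace X)"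
  have "h \<in> topspace (Cp X)"
    unfolding h_def using fg u(1) unfolding topspace_Cp_iff
    by (intro restrict_in_topspace_Cp[unfolded topspace_Cp_iff] continuous_intros) auto
  moreover have "h x = f x" if "x \<in> K" for x
    using u(2) K(2) that unfolding h_def by auto
  moreover have "h x = g x" if "x \<in> L" for x
    using u(3) K(4) that unfolding h_def by auto
  ultimately show thesis using that by blast
qed

section \<open>Finite supports of uniformly continuous maps\<close>

text \<open>
  In Gul'ko's notation this is \<open>a(y, K) \<le> r\<close>. When \<open>K\<close> is finite it plays the role of the support
  of the functional \<open>f \<mapsto> \<phi> f y\<close>, which for a linear \<open>\<phi>\<close> is the finite set of points with nonzero
  coefficients.
\<close>

definition support_bound ::
  "'a topology \<Rightarrow> (('a \<Rightarrow> real) \<Rightarrow> ('b \<Rightarrow> real)) \<Rightarrow> 'b \<Rightarrow> real \<Rightarrow> 'a set \<Rightarrow> bool" where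
  "support_bound X \<phi> y r K \<longleftrightarrow>
     (\<forall>f\<in>topspace (Cp X). \<forall>g\<in>topspace (Cp X). (\<forall>x\<in>K. \<bar>f x - g x\<bar> < 1) \<longrightarrow> \<bar>\<phi> f y - \<phi> g y\<bar> \<le> r)"

lemma support_boundD:
  assumes "support_bound X \<phi> y r K" "f \<in> topspace (Cp X)" "g \<in> topspace (Cp X)" "\<And>x. x \<in> K \<Longrightarrow> \<bar>f x - g x\<bar> < 1"
  shows "\<bar>\<phi> f y - \<phi> g y\<bar> \<le> r"
  using assms unfolding support_bound_def by blast

lemma support_bound_mono:
  "\<lbrakk>support_bound X \<phi> y r K; r \<le> s\<rbrakk> \<Longrightarrow> support_bound X \<phi> y s K"
  unfolding support_bound_def by force

text \<open>
  The segment from \<open>f\<close> to \<open>g\<close> is divided into \<open>n + 1\<close> equal steps, each shorter than \<open>\<delta>\<close> on \<open>K\<close>.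
\<close>

lemma chain_bound:
  fixes f g :: "'a \<Rightarrow> real" and \<delta> r :: real
  assumes step: "\<And>f g. \<lbrakk>f \<in> topspace (Cp X); g \<in> topspace (Cp X); \<forall>x\<in>K. \<bar>f x - g x\<bar> < \<delta>\<rbrakk> \<Longrightarrow> \<bar>\<phi> f y - \<phi> g y\<bar> \<le> r"
    and fg: "f \<in> topspace (Cp X)" "g \<in> topspace (Cp X)"
    and K: "K \<subseteq> topspace X" and close: "\<forall>x\<in>K. \<bar>f x - g x\<bar> < Suc n * \<delta>"
  shows "\<bar>\<phi> f y - \<phi> g y\<bar> \<le> Suc n * r"
  using fg(1) close
proof (induction n arbitrary: f)
  case 0
  then show ?case using step[of f g] fg(2) by simp
next
  case (Suc n)
  define h where "h = restrict (\<lambda>x. f x + (g x - f x) / (n + 2)) (topspace X)"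
  have h: "h \<in> topspace (Cp X)"
    unfolding h_def using fg(2) Suc.prems(1) unfolding topspace_Cp_iff
    by (intro restrict_in_topspace_Cp[unfolded topspace_Cp_iff] continuous_intros) auto
  have hx: "h x = f x + (g x - f x) / (n + 2)" if "x \<in> K" for x
    using that K unfolding h_def by auto
  have d: "\<bar>f x - g x\<bar> / (n + 2) < \<delta>" if "x \<in> K" for x
    using Suc.prems(2) that by (auto simp: field_simps)
  have "\<bar>f x - h x\<bar> < \<delta>" if x: "x \<in> K" for x
  proof -
    have "\<bar>f x - h x\<bar> = \<bar>f x - g x\<bar> / (n + 2)"
      unfolding hx[OF x] by (simp add: abs_minus_commute)
    then show ?thesis using d[OF x] by simp
  qed
  then have 1: "\<bar>\<phi> f y - \<phi> h y\<bar> \<le> r" using step[OF Suc.prems(1) h] by simp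
  have "\<bar>h x - g x\<bar> < Suc n * \<delta>" if x: "x \<in> K" for x
  proof -
    have "h x - g x = Suc n * ((f x - g x) / (n + 2))"
      unfolding hx[OF x] by (simp add: field_simps)
    then have "\<bar>h x - g x\<bar> = Suc n * (\<bar>f x - g x\<bar> / (n + 2))" by (simp add: abs_mult)
    also have "\<dots> < Suc n * \<delta>" using d[OF x] by (intro mult_strict_left_mono) auto
    finally show ?thesis .
  qed
  then have 2: "\<bar>\<phi> h y - \<phi> g y\<bar> \<le> Suc n * r" using Suc.IH[OF h] by simp
  show ?case using 1 2 by (simp add: algebra_simps)
qed

text \<open>
  If functions close on both \<open>K\<close> and on \<open>L\<close> have close images, then one can pass from \<open>f\<close> to \<open>g\<close>
  through a function that equals \<open>f\<close> on \<open>K\<close> and \<open>g\<close> on the rest of \<open>L\<close>.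
\<close>

lemma support_bound_Int:
  assumes X: "normal_space X" "Hausdorff_space X"
    and K: "finite K" "K \<subseteq> topspace X" "finite L" "L \<subseteq> topspace X"
    and b: "support_bound X \<phi> y r K" "support_bound X \<phi> y r L"
  shows "support_bound X \<phi> y (2 * r) (K \<inter> L)"
  unfolding support_bound_def
proof (intro ballI impI)
  fix f g assume fg: "f \<in> topspace (Cp X)" "g \<in> topspace (Cp X)" and c: "\<forall>x\<in>K \<inter> L. \<bar>f x - g x\<bar> < 1"
  have L': "finite (L - K)" "L - K \<subseteq> topspace X" "K \<inter> (L - K) = {}" using K by auto
  obtain h where h: "h \<in> topspace (Cp X)" "\<forall>x\<in>K. h x = f x" "\<forall>x\<in>L-K. h x = g x"
    by (rule finite_interpolation[OF X K(1,2) L' fg])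
  have "\<bar>\<phi> f y - \<phi> h y\<bar> \<le> r" using h by (intro support_boundD[OF b(1) fg(1) h(1)]) auto
  moreover have "\<bar>h x - g x\<bar> < 1" if "x \<in> L" for x
    using h(2,3) c that by (cases "x \<in> K") auto
  then have "\<bar>\<phi> h y - \<phi> g y\<bar> \<le> r" by (intro support_boundD[OF b(2) h(1) fg(2)])
  ultimately show "\<bar>\<phi> f y - \<phi> g y\<bar> \<le> 2 * r" by linarith
qed

lemma continuous_majorant:
  fixes w :: "nat \<Rightarrow> real"
  assumes "\<And>k. w k \<ge> 0"
  obtains u :: "real \<Rightarrow> real" where "continuous_on UNIV u" "\<And>k t. real k \<le> t \<Longrightarrow> w k \<le> u t"
proof -
  \<comment> \<open>a sum of ramps, locally finite: the one with index \<open>j\<close> vanishes up to \<open>j - 1\<close> and is at least \<open>w j\<close> from \<open>j\<close> on\<close>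
  define u where "u t = (\<Sum>j. w j * max 0 (t - j + 1))" for t :: real
  have u: "u t = (\<Sum>j<N + 1. w j * max 0 (t - j + 1))" if "t < N" for t :: real and N :: nat
    unfolding u_def using that by (intro suminf_finite) (auto simp: max_def)
  have "continuous_on {..<real N} u" for N :: nat
  proof -
    have "continuous_on {..<real N} (\<lambda>t. \<Sum>j<N + 1. w j * max 0 (t - j + 1))"
      by (intro continuous_intros)
    then show ?thesis by (rule continuous_on_eq) (simp add: u)
  qed
  then have "continuous_on (\<Union>N::nat. {..<real N}) u"
    by (intro continuous_on_open_UN) auto
  moreover have "(\<Union>N::nat. {..<real N}) = UNIV" using reals_Archimedean2 by blast
  moreover have "w k \<le> u t" if "real k \<le> t" for k t
  proof -
    obtain N :: nat where N: "t < N" using reals_Archimedean2 by blast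
    then have kN: "k < N + 1" using that by linarith
    have "w k \<le> w k * max 0 (t - k + 1)"
      using that assms[of k] mult_left_mono[of 1 "max 0 (t - k + 1)" "w k"] by simp
    also have "\<dots> \<le> (\<Sum>j<N + 1. w j * max 0 (t - j + 1))"
      using kN assms by (intro member_le_sum) auto
    finally show ?thesis using u[OF N] by simp
  qed
  ultimately show thesis using that by metis
qed

locale Cp_surjection =
  fixes X :: "'a topology" and Y :: "'b topology" and \<phi> :: "('a \<Rightarrow> real) \<Rightarrow> ('b \<Rightarrow> real)"
  assumes compact_X: "compact_space X" and metrizable_X: "metrizable_space X"
    and tychonoff_Y: "tychonoff_space Y"
    and unif_cont: "Cp_uniformly_continuous X Y \<phi>"
    and surj: "\<phi> ` topspace (Cp X) = topspace (Cp Y)"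
begin

lemma Hausdorff_X: "Hausdorff_space X" and normal_X: "normal_space X"
  using metrizable_X metrizable_imp_Hausdorff_space metrizable_imp_normal_space by auto

lemma uniformly_continuous_at_point:
  assumes y: "y \<in> topspace Y" and e: "e > 0"
  obtains K \<delta> where "finite K" "K \<subseteq> topspace X" "\<delta> > 0"
    "\<forall>f\<in>topspace (Cp X). \<forall>g\<in>topspace (Cp X). (\<forall>x\<in>K. \<bar>f x - g x\<bar> < \<delta>) \<longrightarrow> \<bar>\<phi> f y - \<phi> g y\<bar> < e"
proof -
  let ?U = "{u \<in> topspace (Cp Y). u y \<in> {-e<..<e}}"
  have "continuous_map (Cp Y) euclideanreal (\<lambda>u. u y)"
    unfolding Cp_def using y by (intro continuous_map_from_subtopology continuous_map_product_projection)
  then have "openin (Cp Y) ?U" by (rule openin_continuous_map_preimage) simp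
  moreover have "Cp_zero Y \<in> ?U"
    using y e restrict_in_topspace_Cp[of Y "\<lambda>_. 0"] unfolding Cp_zero_def by simp
  ultimately obtain V where V: "openin (Cp X) V" "Cp_zero X \<in> V"
      "\<forall>f\<in>topspace (Cp X). \<forall>g\<in>topspace (Cp X). Cp_diff X f g \<in> V \<longrightarrow> Cp_diff Y (\<phi> f) (\<phi> g) \<in> ?U"
    using unif_cont unfolding Cp_uniformly_continuous_def by meson
  obtain K \<delta> where K: "finite K" "K \<subseteq> topspace X" "\<delta> > 0"
      "\<forall>g\<in>topspace (Cp X). (\<forall>x\<in>K. \<bar>g x - Cp_zero X x\<bar> < \<delta>) \<longrightarrow> g \<in> V"
    by (rule ball_in_open_set_Cp[OF V(1,2)])
  have "\<bar>\<phi> f y - \<phi> g y\<bar> < e" if fg: "f \<in> topspace (Cp X)" "g \<in> topspace (Cp X)" and c: "\<forall>x\<in>K. \<bar>f x - g x\<bar> < \<delta>" for f g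
  proof -
    have "Cp_diff X f g \<in> topspace (Cp X)"
      unfolding Cp_diff_def using fg unfolding topspace_Cp_iff
      by (intro restrict_in_topspace_Cp[unfolded topspace_Cp_iff] continuous_intros) auto
    moreover have "\<forall>x\<in>K. \<bar>Cp_diff X f g x - Cp_zero X x\<bar> < \<delta>"
      using c K(2) unfolding Cp_diff_def Cp_zero_def by auto
    ultimately have "Cp_diff X f g \<in> V" using K(4) by blast
    then have "Cp_diff Y (\<phi> f) (\<phi> g) \<in> ?U" using V(3) fg by blast
    then show ?thesis using y unfolding Cp_diff_def by (auto simp: abs_less_iff)
  qed
  then show thesis using K by (intro that[of K \<delta>]) auto
qed

text \<open>
  Uniform continuity yields \<open>\<bar>\<phi> f y - \<phi> g y\<bar> < 1\<close> for functions that are \<open>\<delta>\<close>-close on \<open>K\<close>, with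
  \<open>\<delta>\<close> possibly small. Distance \<open>1\<close> is reached in finitely many such steps.
\<close>

lemma finite_support:
  assumes y: "y \<in> topspace Y"
  obtains K r where "finite K" "K \<subseteq> topspace X" "support_bound X \<phi> y (real r) K"
proof -
  obtain K \<delta> where K: "finite K" "K \<subseteq> topspace X" "\<delta> > 0"
    "\<forall>f\<in>topspace (Cp X). \<forall>g\<in>topspace (Cp X). (\<forall>x\<in>K. \<bar>f x - g x\<bar> < \<delta>) \<longrightarrow> \<bar>\<phi> f y - \<phi> g y\<bar> < 1"
    by (rule uniformly_continuous_at_point[OF y zero_less_one])
  obtain n where n: "1 / Suc n < \<delta>" using K(3) by (rule nat_approx_posE)
  have "support_bound X \<phi> y (real (Suc n)) K"
    unfolding support_bound_def
  proof (intro ballI impI)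
    fix f g assume fg: "f \<in> topspace (Cp X)" "g \<in> topspace (Cp X)" and c: "\<forall>x\<in>K. \<bar>f x - g x\<bar> < 1"
    have "1 < Suc n * \<delta>" using n by (simp add: field_simps)
    then have "\<forall>x\<in>K. \<bar>f x - g x\<bar> < Suc n * \<delta>" using c by force
    then have "\<bar>\<phi> f y - \<phi> g y\<bar> \<le> real (Suc n) * 1"
      using K(4) by (intro chain_bound[OF _ fg K(2)]) (auto intro: less_imp_le)
    then show "\<bar>\<phi> f y - \<phi> g y\<bar> \<le> real (Suc n)" by simp
  qed
  then show thesis using K that by blast
qed

text \<open>
  The images of the functions of norm at most \<open>k\<close> are pointwise bounded. If \<open>h\<close> were an unbounded
  continuous function, with \<open>\<bar>h (y k)\<bar> \<ge> k\<close>, a continuous function of \<open>\<bar>h\<bar>\<close> could exceed these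
  bounds at all points \<open>y k\<close>; yet it is the image of a bounded function.
\<close>

lemma pseudocompact_Y: "pseudocompact_space Y"
  unfolding pseudocompact_space_def
proof (intro allI impI, rule ccontr)
  fix h assume h: "continuous_map Y euclideanreal h" and "\<nexists>b. \<forall>y\<in>topspace Y. \<bar>h y\<bar> \<le> b"
  then have "\<forall>k::nat. \<exists>y\<in>topspace Y. real k \<le> \<bar>h y\<bar>" by (meson linear)
  then obtain y where y: "\<And>k. y k \<in> topspace Y" "\<And>k. real k \<le> \<bar>h (y k)\<bar>" by metis
  have "\<exists>K r. K \<subseteq> topspace X \<and> support_bound X \<phi> (y k) (real r) K" for k
    using finite_support[OF y(1)] by metis
  then obtain K r where K: "\<And>k. K k \<subseteq> topspace X" "\<And>k. support_bound X \<phi> (y k) (real (r k)) (K k)"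
    by metis
  define z where "z = restrict (\<lambda>_. 0::real) (topspace X)"
  have z: "z \<in> topspace (Cp X)" unfolding z_def by (rule restrict_in_topspace_Cp) simp
  define w where "w k = \<bar>\<phi> z (y k)\<bar> + Suc k * real (r k) + 1" for k
  have "w k \<ge> 0" for k unfolding w_def by simp
  then obtain u where u: "continuous_on UNIV u" "\<And>k t. real k \<le> t \<Longrightarrow> w k \<le> u t"
    using continuous_majorant by metis
  define g where "g = restrict (\<lambda>y. u \<bar>h y\<bar>) (topspace Y)"
  have "continuous_map Y euclideanreal (u \<circ> (\<lambda>y. \<bar>h y\<bar>))"
    using h u(1) by (intro continuous_map_compose[of _ euclideanreal] continuous_map_real_abs) auto
  then have "g \<in> topspace (Cp Y)"
    unfolding g_def by (intro restrict_in_topspace_Cp) (simp add: o_def)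
  then obtain f where f: "f \<in> topspace (Cp X)" "\<phi> f = g" using surj by (metis imageE)
  obtain b where b: "\<And>x. x \<in> topspace X \<Longrightarrow> \<bar>f x\<bar> \<le> b"
    using bounded_if_continuous_on_compact[OF compact_X f(1)] by blast
  obtain k :: nat where k: "b < k" using reals_Archimedean2 by blast
  have "\<bar>\<phi> f (y k) - \<phi> z (y k)\<bar> \<le> Suc k * real (r k)"
  proof (rule chain_bound[OF _ f(1) z K(1)])
    show "\<forall>x\<in>K k. \<bar>f x - z x\<bar> < real (Suc k) * 1"
    proof
      fix x assume "x \<in> K k"
      then have "x \<in> topspace X" using K(1) by blast
      then show "\<bar>f x - z x\<bar> < real (Suc k) * 1" using b[of x] k unfolding z_def by simp
    qed
  qed (use K(2) in \<open>auto simp: support_bound_def\<close>)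
  moreover have "\<phi> f (y k) \<ge> w k"
    unfolding f(2) g_def using y u(2) by simp
  ultimately show False unfolding w_def by linarith
qed

text \<open>
  A function on \<open>Y\<close> that separates \<open>y\<close> from \<open>z\<close> is the image of some \<open>f\<close>. By continuity of \<open>\<phi>\<close> at
  \<open>f\<close>, a member of a countable dense set that is close to \<open>f\<close> has an image that still separates
  the two points.
\<close>

lemma countable_separating_family:
  obtains G :: "nat \<Rightarrow> 'b \<Rightarrow> real" where "\<forall>n. continuous_map Y euclideanreal (G n)"
    "\<forall>y\<in>topspace Y. \<forall>z\<in>topspace Y. y \<noteq> z \<longrightarrow> (\<exists>n. G n y \<noteq> G n z)"
proof -
  obtain D where D: "countable D" "D \<subseteq> topspace (Cp X)"
    "\<And>f K e. \<lbrakk>f \<in> topspace (Cp X); finite K; K \<subseteq> topspace X; e > 0\<rbrakk> \<Longrightarrow> \<exists>g\<in>D. \<forall>x\<in>K. \<bar>g x - f x\<bar> < e"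
    using Cp_separable[OF compact_X metrizable_X] by metis
  have "restrict (\<lambda>_. 0) (topspace X) \<in> topspace (Cp X)" by (rule restrict_in_topspace_Cp) simp
  then have ne: "D \<noteq> {}" using D(3)[of _ "{}" 1] by fastforce
  define G where "G n = \<phi> (from_nat_into D n)" for n
  have "continuous_map Y euclideanreal (G n)" for n
    using from_nat_into[OF ne, of n] D(2) surj unfolding G_def by (metis imageI subsetD topspace_Cp_iff)
  moreover have "\<exists>n. G n y \<noteq> G n z" if yz: "y \<in> topspace Y" "z \<in> topspace Y" "y \<noteq> z" for y z
  proof -
    have "closedin Y {z}" using tychonoff_Y yz(2) unfolding tychonoff_space_def
      by (simp add: closedin_Hausdorff_singleton)
    moreover have "y \<in> topspace Y - {z}" using yz by blast
    ultimately obtain k :: "'b \<Rightarrow> real" where k: "continuous_map Y (top_of_set {0..1}) k" "k y = 0" "k ` {z} \<subseteq> {1}"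
      using tychonoff_Y unfolding tychonoff_space_def completely_regular_space_def by metis
    then have "restrict k (topspace Y) \<in> topspace (Cp Y)"
      by (intro restrict_in_topspace_Cp) (simp add: continuous_map_in_subtopology)
    then obtain f where f: "f \<in> topspace (Cp X)" "\<phi> f = restrict k (topspace Y)" using surj by (metis imageE)
    obtain K \<delta> where K: "finite K" "K \<subseteq> topspace X" "\<delta> > 0"
      "\<forall>f\<in>topspace (Cp X). \<forall>g\<in>topspace (Cp X). (\<forall>x\<in>K. \<bar>f x - g x\<bar> < \<delta>) \<longrightarrow> \<bar>\<phi> f y - \<phi> g y\<bar> < 1/2"
      by (rule uniformly_continuous_at_point[OF yz(1), of "1/2"]) auto
    obtain L \<epsilon> where L: "finite L" "L \<subseteq> topspace X" "\<epsilon> > 0"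
      "\<forall>f\<in>topspace (Cp X). \<forall>g\<in>topspace (Cp X). (\<forall>x\<in>L. \<bar>f x - g x\<bar> < \<epsilon>) \<longrightarrow> \<bar>\<phi> f z - \<phi> g z\<bar> < 1/2"
      by (rule uniformly_continuous_at_point[OF yz(2), of "1/2"]) auto
    obtain g where g: "g \<in> D" "\<forall>x\<in>K \<union> L. \<bar>g x - f x\<bar> < min \<delta> \<epsilon>"
      using D(3)[OF f(1), of "K \<union> L" "min \<delta> \<epsilon>"] K L by auto
    then have gC: "g \<in> topspace (Cp X)" using D(2) by blast
    have "\<bar>\<phi> g y - \<phi> f y\<bar> < 1/2" using K(4) g(2) gC f(1) by auto
    moreover have "\<bar>\<phi> g z - \<phi> f z\<bar> < 1/2" using L(4) g(2) gC f(1) by auto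
    moreover have "\<phi> f y = 0" "\<phi> f z = 1" using f(2) k yz by auto
    ultimately have "\<phi> g y \<noteq> \<phi> g z" by auto
    moreover obtain n where "from_nat_into D n = g" using from_nat_into_surj[OF D(1) g(1)] by blast
    ultimately show ?thesis unfolding G_def by metis
  qed
  ultimately show thesis using that by metis
qed

lemma compact_metrizable_Y: "compact_space Y \<and> metrizable_space Y"
proof -
  obtain G :: "nat \<Rightarrow> 'b \<Rightarrow> real" where G: "\<forall>n. continuous_map Y euclideanreal (G n)"
    "\<forall>y\<in>topspace Y. \<forall>z\<in>topspace Y. y \<noteq> z \<longrightarrow> (\<exists>n. G n y \<noteq> G n z)"
    by (rule countable_separating_family)
  show ?thesis
    by (rule compact_metrizable_if_pseudocompact[where G = G])
       (use G tychonoff_Y pseudocompact_Y in \<open>auto simp: tychonoff_space_def\<close>)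
qed

end

section \<open>Decomposition of the codomain\<close>

context Cp_surjection
begin

lemma Hausdorff_Y: "Hausdorff_space Y" and normal_Y: "normal_space Y"
  using compact_metrizable_Y metrizable_imp_Hausdorff_space metrizable_imp_normal_space by auto

abbreviation X_power :: "nat \<Rightarrow> (nat \<Rightarrow> 'a) topology" where
  "X_power q \<equiv> product_topology (\<lambda>_. X) {..<q}"

text \<open>
  Supports are enumerated by tuples, with repetitions possible: the power of \<open>X\<close> supplies a compact
  Hausdorff topology on them, and for the dimension it is a product of known factors.
\<close>

definition support_graph :: "nat \<Rightarrow> real \<Rightarrow> ('b \<times> (nat \<Rightarrow> 'a)) set" where
  "support_graph q r =
     {(y, x). y \<in> topspace Y \<and> x \<in> topspace (X_power q) \<and> support_bound X \<phi> y r (x ` {..<q})}"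

lemma compact_X_power: "compact_space (X_power q)"
  using compact_X by (simp add: compact_space_product_topology)

lemma Hausdorff_X_power: "Hausdorff_space (X_power q)"
  using Hausdorff_X by (simp add: Hausdorff_space_product_topology)

text \<open>
  For fixed \<open>f\<close> and \<open>g\<close> the defining implication holds on a closed set of pairs, since its premise is
  an open condition on the tuple and its conclusion a closed condition on \<open>y\<close>.
\<close>

lemma closedin_support_graph: "closedin (prod_topology Y (X_power q)) (support_graph q r)"
proof -
  let ?P = "prod_topology Y (X_power q)"
  define T where "T f g = (\<Union>i<q. {p \<in> topspace ?P. \<bar>f (snd p i) - g (snd p i)\<bar> \<in> {1..}}) \<union>
      {p \<in> topspace ?P. \<bar>\<phi> f (fst p) - \<phi> g (fst p)\<bar> \<in> {..r}}" for f g
  have *: "closedin ?P (T f g)" if fg: "f \<in> topspace (Cp X)" "g \<in> topspace (Cp X)" for f g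
  proof -
    have proj: "continuous_map ?P X (\<lambda>p. snd p i)" if "i < q" for i
      using continuous_map_compose[OF continuous_map_snd continuous_map_product_projection[of i "{..<q}" "\<lambda>_. X"]]
        that by (simp add: o_def)
    have "continuous_map ?P euclideanreal (\<lambda>p. f (snd p i))" "continuous_map ?P euclideanreal (\<lambda>p. g (snd p i))"
      if "i < q" for i
      using continuous_map_compose[OF proj[OF that]] fg unfolding topspace_Cp_iff by (auto simp: o_def)
    then have 1: "closedin ?P {p \<in> topspace ?P. \<bar>f (snd p i) - g (snd p i)\<bar> \<in> {1..}}" if "i < q" for i
      using that by (intro closedin_continuous_map_preimage[of _ euclideanreal] continuous_intros) auto
    have "continuous_map Y euclideanreal (\<phi> f)" "continuous_map Y euclideanreal (\<phi> g)"
      using fg surj topspace_Cp_iff by blast+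
    then have "continuous_map ?P euclideanreal (\<lambda>p. \<phi> f (fst p))" "continuous_map ?P euclideanreal (\<lambda>p. \<phi> g (fst p))"
      using continuous_map_compose[OF continuous_map_fst] by (auto simp: o_def)
    then have 2: "closedin ?P {p \<in> topspace ?P. \<bar>\<phi> f (fst p) - \<phi> g (fst p)\<bar> \<in> {..r}}"
      by (intro closedin_continuous_map_preimage[of _ euclideanreal] continuous_intros) auto
    show ?thesis unfolding T_def using 1 2 by (intro closedin_Un closedin_Union) auto
  qed
  have mem: "p \<in> support_graph q r \<longleftrightarrow> p \<in> topspace ?P \<and> (\<forall>f\<in>topspace (Cp X). \<forall>g\<in>topspace (Cp X). p \<in> T f g)" for p
  proof -
    have "p \<in> T f g \<longleftrightarrow>
        ((\<forall>x\<in>snd p ` {..<q}. \<bar>f x - g x\<bar> < 1) \<longrightarrow> \<bar>\<phi> f (fst p) - \<phi> g (fst p)\<bar> \<le> r)"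
      if "p \<in> topspace ?P" for f g
      using that unfolding T_def by (auto simp: not_le not_less Ball_def linorder_not_less)
    then show ?thesis unfolding support_graph_def support_bound_def by (cases p) auto
  qed
  have "support_graph q r = topspace ?P - (\<Union>f\<in>topspace (Cp X). \<Union>g\<in>topspace (Cp X). topspace ?P - T f g)"
    using mem by blast
  moreover have "openin ?P (\<Union>f\<in>topspace (Cp X). \<Union>g\<in>topspace (Cp X). topspace ?P - T f g)"
  proof -
    have "openin ?P (topspace ?P - T f g)" if "f \<in> topspace (Cp X)" "g \<in> topspace (Cp X)" for f g
      using *[OF that] by (intro openin_diff openin_topspace)
    then have "openin ?P (\<Union>g\<in>topspace (Cp X). topspace ?P - T f g)" if "f \<in> topspace (Cp X)" for f
      using that by (intro openin_Union) blast
    then show ?thesis by (intro openin_Union) blast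
  qed
  ultimately show ?thesis by (metis closedin_diff closedin_topspace)
qed

lemma closedin_points_with_small_support: "closedin Y (fst ` support_graph q r)"
  using closed_map_fst[OF compact_X_power] closedin_support_graph unfolding closed_map_def by blast

text \<open>
  Suppose that over each point of \<open>F\<close> all tuples of the graph enumerate the same set. Over a point
  of \<open>A\<close> exactly one of them lies in the product of the disjoint sets \<open>C i\<close>. This defines a map from
  \<open>A\<close> to the product; it is continuous because its graph is closed and the product is compact, and
  it is finite-to-one because only finitely many points have a given support. Hence the dimension
  of \<open>A\<close> is at most that of the product.
\<close>

lemma dim_of_piece:
  assumes F: "closedin Y F"
    and unique: "\<And>y x x'. \<lbrakk>y \<in> F; (y, x) \<in> support_graph q r; (y, x') \<in> support_graph q r\<rbrakk> \<Longrightarrow> x ` {..<q} = x' ` {..<q}"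
    and fin: "\<And>K. \<lbrakk>finite K; K \<subseteq> topspace X\<rbrakk> \<Longrightarrow> finite {y \<in> topspace Y. support_bound X \<phi> y r K}"
    and C: "\<And>i. i < q \<Longrightarrow> closedin X (C i)" and disj: "\<And>i j. \<lbrakk>i < q; j < q; i \<noteq> j\<rbrakk> \<Longrightarrow> C i \<inter> C j = {}"
    and dim: "\<And>i. i < q \<Longrightarrow> covering_dim_le (subtopology X (C i)) (d i)"
  defines "A \<equiv> {y \<in> F. \<exists>x\<in>PiE {..<q} C. (y, x) \<in> support_graph q r}"
  shows "closedin Y A" "covering_dim_le (subtopology Y A) ((\<Prod>i<q. d i + 1) - 1)"
proof -
  let ?P = "prod_topology Y (X_power q)"
  have clC: "closedin (X_power q) (PiE {..<q} C)"
    using C by (simp add: closedin_product_topology)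
  define \<Gamma> where "\<Gamma> = support_graph q r \<inter> (F \<times> PiE {..<q} C)"
  have cl: "closedin Y (fst ` (\<Gamma> \<inter> (topspace Y \<times> D)))" if D: "closedin (X_power q) D" for D
  proof -
    have "closedin ?P (\<Gamma> \<inter> (topspace Y \<times> D))"
      unfolding \<Gamma>_def using closedin_support_graph F clC D
      by (intro closedin_Int) (auto simp: closedin_prod_Times_iff)
    then show ?thesis using closed_map_fst[OF compact_X_power] unfolding closed_map_def by blast
  qed
  have \<Gamma>Y: "\<Gamma> \<subseteq> topspace Y \<times> topspace (X_power q)" unfolding \<Gamma>_def support_graph_def by auto
  have A: "A = fst ` \<Gamma>" unfolding A_def \<Gamma>_def by force
  also have "\<Gamma> = \<Gamma> \<inter> (topspace Y \<times> topspace (X_power q))" using \<Gamma>Y by blast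
  finally show clA: "closedin Y A" using cl[OF closedin_topspace] by simp
  have AY: "A \<subseteq> topspace Y" using clA by (rule closedin_subset)
  have uniq: "x = x'" if "(y, x) \<in> \<Gamma>" "(y, x') \<in> \<Gamma>" for y x x'
  proof
    fix i
    have x: "x \<in> PiE {..<q} C" "x' \<in> PiE {..<q} C" using that unfolding \<Gamma>_def by auto
    show "x i = x' i"
    proof (cases "i < q")
      case True
      have "x ` {..<q} = x' ` {..<q}"
        by (rule unique[of y]) (use that in \<open>simp_all add: \<Gamma>_def\<close>)
      then obtain j where j: "j < q" "x i = x' j" using True by (metis imageE imageI lessThan_iff)
      then have "x i \<in> C i \<inter> C j" using x True by (metis IntI PiE_mem lessThan_iff)
      then show ?thesis using disj[OF True j(1)] j(2) by auto
    next
      case False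
      then show ?thesis using x by (auto simp: PiE_def extensional_def)
    qed
  qed
  define k where "k y = (THE x. (y, x) \<in> \<Gamma>)" for y
  have k: "k y = x" if "(y, x) \<in> \<Gamma>" for y x
    unfolding k_def using that uniq by (intro the_equality) auto
  have kG: "(y, k y) \<in> \<Gamma>" if "y \<in> A" for y
    using that k unfolding A by auto
  let ?S = "product_topology (\<lambda>i. subtopology X (C i)) {..<q}"
  have S: "?S = subtopology (X_power q) (PiE {..<q} C)" by (rule subtopology_product_topology[symmetric])
  have topA: "topspace (subtopology Y A) = A" using AY by auto
  have "continuous_map (subtopology Y A) ?S k"
    unfolding continuous_map_closedin topA
  proof (intro conjI allI impI)
    show "k \<in> A \<rightarrow> topspace ?S"
    proof
      fix y assume "y \<in> A"
      then have "(y, k y) \<in> \<Gamma>" by (rule kG)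
      then have "k y \<in> topspace (X_power q)" "k y \<in> PiE {..<q} C"
        using \<Gamma>Y unfolding \<Gamma>_def by blast+
      then show "k y \<in> topspace ?S" unfolding S topspace_subtopology by blast
    qed
    fix D assume D: "closedin ?S D"
    then have "closedin (X_power q) D"
      unfolding S using clC by (simp add: closedin_closed_subtopology)
    moreover have "{y \<in> A. k y \<in> D} = fst ` (\<Gamma> \<inter> (topspace Y \<times> D))"
    proof
      show "{y \<in> A. k y \<in> D} \<subseteq> fst ` (\<Gamma> \<inter> (topspace Y \<times> D))"
      proof clarify
        fix y assume "y \<in> A" "k y \<in> D"
        then have "(y, k y) \<in> \<Gamma> \<inter> (topspace Y \<times> D)" using kG AY by blast
        then show "y \<in> fst ` (\<Gamma> \<inter> (topspace Y \<times> D))" by force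
      qed
      show "fst ` (\<Gamma> \<inter> (topspace Y \<times> D)) \<subseteq> {y \<in> A. k y \<in> D}"
        using k unfolding A by force
    qed
    ultimately have "closedin Y {y \<in> A. k y \<in> D}" using cl by simp
    then show "closedin (subtopology Y A) {y \<in> A. k y \<in> D}"
      using clA by (simp add: closedin_closed_subtopology)
  qed
  moreover have "compact_space (subtopology Y A)"
    using clA compact_metrizable_Y closedin_compact_space compact_space_subtopology by blast
  moreover have "Hausdorff_space (subtopology Y A)"
    using Hausdorff_Y by (rule Hausdorff_space_subtopology)
  moreover have compC: "compact_space (subtopology X (C i))" if "i < q" for i
    using C[OF that] compact_X closedin_compact_space compact_space_subtopology by blast
  then have "compact_space ?S"
    by (simp add: compact_space_product_topology)
  moreover have "Hausdorff_space ?S"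
    unfolding S by (rule Hausdorff_space_subtopology[OF Hausdorff_X_power])
  moreover have "finite {y \<in> topspace (subtopology Y A). k y = s}" if s: "s \<in> topspace ?S" for s
  proof (rule finite_subset)
    show "finite {y \<in> topspace Y. support_bound X \<phi> y r (s ` {..<q})}"
      using s by (intro fin) (auto simp: S)
    show "{y \<in> topspace (subtopology Y A). k y = s} \<subseteq> {y \<in> topspace Y. support_bound X \<phi> y r (s ` {..<q})}"
      using kG unfolding topA \<Gamma>_def support_graph_def by auto
  qed
  moreover have "covering_dim_le ?S ((\<Prod>i<q. d i + 1) - 1)"
    using compC dim metrizable_X metrizable_space_subtopology
    by (intro covering_dim_le_product) auto
  ultimately show "covering_dim_le (subtopology Y A) ((\<Prod>i<q. d i + 1) - 1)"
    by (intro covering_dim_le_finite_to_one[of "subtopology Y A" ?S k]) assumption+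
qed

text \<open>
  Doubling the bound in the subtracted part is what makes supports of size \<open>q\<close> unique here: the
  intersection of two of them is a support with bound \<open>2 * r\<close>, so it cannot have fewer than \<open>q\<close>
  points.
\<close>

definition stratum :: "nat \<Rightarrow> real \<Rightarrow> 'b set" where
  "stratum q r = fst ` support_graph q r - (\<Union>n<q. fst ` support_graph n (2 * r))"

lemma small_support_iff:
  assumes "y \<in> topspace Y"
  shows "y \<in> fst ` support_graph q r \<longleftrightarrow> (\<exists>x \<in> topspace (X_power q). support_bound X \<phi> y r (x ` {..<q}))"
proof
  assume "y \<in> fst ` support_graph q r"
  then obtain x where "(y, x) \<in> support_graph q r" by auto
  then show "\<exists>x \<in> topspace (X_power q). support_bound X \<phi> y r (x ` {..<q})"
    unfolding support_graph_def by blast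
next
  assume "\<exists>x \<in> topspace (X_power q). support_bound X \<phi> y r (x ` {..<q})"
  then obtain x where "(y, x) \<in> support_graph q r"
    using assms unfolding support_graph_def by blast
  then show "y \<in> fst ` support_graph q r" by (metis fst_conv imageI)
qed

lemma support_card_ge:
  assumes y: "y \<in> topspace Y" and notin: "y \<notin> (\<Union>n<q. fst ` support_graph n r)"
    and K: "finite K" "K \<subseteq> topspace X" "support_bound X \<phi> y r K"
  shows "q \<le> card K"
proof (rule ccontr)
  assume less: "\<not> q \<le> card K"
  obtain b where b: "bij_betw b {..<card K} K"
    using ex_bij_betw_nat_finite[OF K(1)] by (metis lessThan_atLeast0)
  define x where "x = restrict b {..<card K}"
  have "x ` {..<card K} = K" using b unfolding x_def bij_betw_def by auto
  moreover from this have "x \<in> topspace (X_power (card K))" using K(2) unfolding x_def by auto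
  ultimately have "y \<in> fst ` support_graph (card K) r"
    unfolding small_support_iff[OF y] using K(3) by (intro bexI[of _ x]) simp_all
  then show False using notin less by auto
qed

lemma stratum_unique_support:
  assumes y: "y \<in> stratum q r" and x: "(y, x) \<in> support_graph q r"
    and x': "(y, x') \<in> support_graph q r"
  shows "x ` {..<q} = x' ` {..<q}" "inj_on x {..<q}"
proof -
  let ?K = "x ` {..<q}" and ?L = "x' ` {..<q}"
  have yY: "y \<in> topspace Y" using x unfolding support_graph_def by auto
  have K: "finite ?K" "?K \<subseteq> topspace X" "finite ?L" "?L \<subseteq> topspace X"
    "support_bound X \<phi> y r ?K" "support_bound X \<phi> y r ?L"
    using x x' unfolding support_graph_def by auto
  have "support_bound X \<phi> y (2 * r) (?K \<inter> ?L)"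
    by (rule support_bound_Int[OF normal_X Hausdorff_X K])
  moreover have "finite (?K \<inter> ?L)" "?K \<inter> ?L \<subseteq> topspace X" using K by auto
  moreover have "y \<notin> (\<Union>n<q. fst ` support_graph n (2 * r))" using y unfolding stratum_def by blast
  ultimately have ge: "q \<le> card (?K \<inter> ?L)" using support_card_ge[OF yY] by metis
  have le: "card ?K \<le> q" "card ?L \<le> q" using card_image_le[of "{..<q}"] by (metis card_lessThan finite_lessThan)+
  have "?K \<inter> ?L = ?K" using ge le K(1) by (intro card_seteq) auto
  moreover have "?K \<inter> ?L = ?L" using ge le K(3) by (intro card_seteq) auto
  ultimately show "?K = ?L" by simp
  have "card ?K = q" using ge le card_mono[of ?K "?K \<inter> ?L"] K(1) by (meson Int_lower1 le_antisym le_trans)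
  then show "inj_on x {..<q}" by (intro eq_card_imp_inj_on) auto
qed

text \<open>
  Here \<open>q\<close> is the least number of points of a support of \<open>y\<close> with any bound whatsoever, so that
  doubling the bound does not lead to smaller supports.
\<close>

lemma ex_stratum:
  assumes y: "y \<in> topspace Y"
  shows "\<exists>q p. y \<in> stratum q (real p)"
proof -
  define Q where "Q n = (\<exists>p K. finite K \<and> K \<subseteq> topspace X \<and> card K = n \<and> support_bound X \<phi> y (real p) K)" for n
  have "\<exists>n. Q n"
    using finite_support[OF y] unfolding Q_def by metis
  then have Qq: "Q (LEAST n. Q n)" by (rule LeastI_ex)
  define q where "q = (LEAST n. Q n)"
  obtain p K where K: "finite K" "K \<subseteq> topspace X" "card K = q" "support_bound X \<phi> y (real p) K"
    using Qq unfolding Q_def q_def by blast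
  have "y \<in> fst ` support_graph n (2 * real p) \<Longrightarrow> q \<le> n" for n
  proof -
    assume "y \<in> fst ` support_graph n (2 * real p)"
    then obtain x where x: "x \<in> topspace (X_power n)" "support_bound X \<phi> y (2 * real p) (x ` {..<n})"
      unfolding small_support_iff[OF y] by blast
    have "support_bound X \<phi> y (real (2 * p)) (x ` {..<n})" using x(2) by simp
    moreover have "finite (x ` {..<n})" "x ` {..<n} \<subseteq> topspace X" using x(1) by auto
    ultimately have "Q (card (x ` {..<n}))" unfolding Q_def by blast
    then have "q \<le> card (x ` {..<n})" unfolding q_def by (rule Least_le)
    also have "\<dots> \<le> n" using card_image_le[of "{..<n}" x] by simp
    finally show ?thesis .
  qed
  then have "y \<notin> (\<Union>n<q. fst ` support_graph n (2 * real p))" by fastforce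
  moreover have "y \<in> fst ` support_graph q (real p)"
  proof (rule ccontr)
    assume "y \<notin> fst ` support_graph q (real p)"
    moreover have "y \<notin> fst ` support_graph n (real p)" if "n < q" for n
    proof
      assume "y \<in> fst ` support_graph n (real p)"
      then have "y \<in> fst ` support_graph n (2 * real p)"
        unfolding small_support_iff[OF y] using support_bound_mono[of X \<phi> y "real p" _ "2 * real p"] by auto
      then show False using \<open>y \<notin> (\<Union>n<q. fst ` support_graph n (2 * real p))\<close> that by blast
    qed
    ultimately have "y \<notin> (\<Union>n<Suc q. fst ` support_graph n (real p))" by (metis UN_E lessThan_iff less_Suc_eq)
    then have "Suc q \<le> card K" using support_card_ge[OF y _ K(1,2,4)] by blast
    then show False using K(3) by simp
  qed
  ultimately show ?thesis unfolding stratum_def by blast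
qed

lemma stratum_fsigma:
  "\<exists>F :: nat \<Rightarrow> 'b set. (\<forall>j. closedin Y (F j)) \<and> (\<Union>j. F j) = stratum q r"
proof -
  have "closedin Y (\<Union>n<q. fst ` support_graph n (2 * r))"
    using closedin_points_with_small_support by (intro closedin_Union) auto
  then have "openin Y (topspace Y - (\<Union>n<q. fst ` support_graph n (2 * r)))" by blast
  then have "fsigma_in Y (topspace Y - (\<Union>n<q. fst ` support_graph n (2 * r)))"
    using compact_metrizable_Y open_imp_fsigma_in by blast
  then have "fsigma_in Y (fst ` support_graph q r \<inter> (topspace Y - (\<Union>n<q. fst ` support_graph n (2 * r))))"
    using closedin_points_with_small_support closed_imp_fsigma_in fsigma_in_Int by blast
  moreover have "fst ` support_graph q r \<inter> (topspace Y - (\<Union>n<q. fst ` support_graph n (2 * r))) = stratum q r"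
    using closedin_subset[OF closedin_points_with_small_support] unfolding stratum_def by blast
  ultimately show ?thesis unfolding fsigma_in_ascending by auto
qed

end

locale c_good_surjection = Cp_surjection +
  fixes c :: real
  assumes c_pos: "c > 0" and good: "c_good c X Y \<phi>"
begin

text \<open>
  Each of the \<open>2 ^ card B\<close> functions from \<open>B\<close> to \<open>{-L, L}\<close> extends to a function on \<open>Y\<close> of norm
  at most \<open>L\<close>, which has a preimage of norm at most \<open>c * L\<close>. If \<open>2 * L > r\<close> and \<open>K\<close> supports all
  points of \<open>B\<close> with bound \<open>r\<close>, then distinct preimages differ by at least \<open>1\<close> somewhere
  on \<open>K\<close>. This bounds \<open>card B\<close> in terms of \<open>c\<close>, \<open>r\<close> and \<open>card K\<close>.
\<close>

lemma finitely_many_points_with_support: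
  assumes K: "finite K" "K \<subseteq> topspace X"
  shows "finite {y \<in> topspace Y. support_bound X \<phi> y r K}"
proof -
  define L where "L = \<bar>r\<bar> + 1"
  have L: "L > 0" "2 * L > r" unfolding L_def by auto
  define N where "N = \<lfloor>c * L\<rfloor> + 1"
  define cells where "cells = PiE K (\<lambda>_. {-N..N})"
  have fin: "finite cells" unfolding cells_def using K(1) by (intro finite_PiE) auto
  have "card B \<le> card cells" if B: "B \<subseteq> {y \<in> topspace Y. support_bound X \<phi> y r K}" "finite B" for B
  proof -
    have "\<exists>f\<in>topspace (Cp X). (\<forall>x\<in>topspace X. \<bar>f x\<bar> \<le> c * L) \<and> (\<forall>y\<in>B. \<phi> f y = (if y \<in> S then L else -L))"
      if S: "S \<subseteq> B" for S
    proof -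
      have "closedin Y (B - S)" "closedin Y S" using B S Hausdorff_Y
        by (auto intro!: closedin_Hausdorff_finite intro: finite_subset)
      moreover have "disjnt (B - S) S" unfolding disjnt_def by blast
      ultimately obtain u where u: "continuous_map Y (top_of_set {-L..L}) u" "u ` (B - S) \<subseteq> {-L}" "u ` S \<subseteq> {L}"
        using Urysohn_lemma[OF normal_Y, of "B - S" S "-L" L] L(1) by auto
      define g where "g = restrict u (topspace Y)"
      have g: "g \<in> topspace (Cp Y)"
        unfolding g_def using u(1) by (intro restrict_in_topspace_Cp) (simp add: continuous_map_in_subtopology)
      have "\<bar>u y\<bar> \<le> L" if "y \<in> topspace Y" for y
        using u(1) that by (force simp: continuous_map_in_subtopology abs_le_iff Pi_iff)
      then have "sup_norm Y g \<le> ennreal L"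
        unfolding sup_norm_def g_def by (intro SUP_least) (simp add: ennreal_leI)
      moreover obtain f where f: "f \<in> topspace (Cp X)" "\<phi> f = g" "sup_norm X f \<le> ennreal c * sup_norm Y g"
        using good g unfolding c_good_def by blast
      ultimately have "sup_norm X f \<le> ennreal c * ennreal L"
        by (meson mult_left_mono order_trans zero_le)
      then have norm: "sup_norm X f \<le> ennreal (c * L)" using c_pos L(1) by (simp add: ennreal_mult)
      have "\<bar>f x\<bar> \<le> c * L" if "x \<in> topspace X" for x
      proof -
        have "ennreal \<bar>f x\<bar> \<le> sup_norm X f" unfolding sup_norm_def using that by (rule SUP_upper)
        then have "ennreal \<bar>f x\<bar> \<le> ennreal (c * L)" using norm by (rule order_trans)
        then show ?thesis using c_pos L(1) by (simp add: ennreal_le_iff)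
      qed
      moreover have "\<phi> f y = (if y \<in> S then L else -L)" if "y \<in> B" for y
        using f(2) u(2,3) that B(1) unfolding g_def by auto
      ultimately show ?thesis using f(1) by blast
    qed
    then obtain f where f: "\<And>S. S \<subseteq> B \<Longrightarrow> f S \<in> topspace (Cp X)"
        "\<And>S x. \<lbrakk>S \<subseteq> B; x \<in> topspace X\<rbrakk> \<Longrightarrow> \<bar>f S x\<bar> \<le> c * L"
        "\<And>S y. \<lbrakk>S \<subseteq> B; y \<in> B\<rbrakk> \<Longrightarrow> \<phi> (f S) y = (if y \<in> S then L else -L)"
      by metis
    \<comment> \<open>functions with equal integer parts on \<open>K\<close> differ by less than \<open>1\<close> there\<close>
    define cell where "cell S = restrict (\<lambda>x. \<lfloor>f S x\<rfloor>) K" for S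
    have "inj_on cell (Pow B)"
    proof (rule inj_onI)
      fix S T assume ST: "S \<in> Pow B" "T \<in> Pow B" "cell S = cell T"
      have close: "\<bar>f S x - f T x\<bar> < 1" if "x \<in> K" for x
      proof -
        have "\<lfloor>f S x\<rfloor> = \<lfloor>f T x\<rfloor>" using ST(3) that unfolding cell_def by (metis restrict_apply')
        then show ?thesis by linarith
      qed
      have "y \<in> S \<longleftrightarrow> y \<in> T" if y: "y \<in> B" for y
      proof (rule ccontr)
        assume ne: "\<not> (y \<in> S \<longleftrightarrow> y \<in> T)"
        have sub: "S \<subseteq> B" "T \<subseteq> B" using ST by auto
        have "support_bound X \<phi> y r K" using B(1) y by blast
        then have "\<bar>\<phi> (f S) y - \<phi> (f T) y\<bar> \<le> r"
          using f(1)[OF sub(1)] f(1)[OF sub(2)] close by (rule support_boundD)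
        then show False
          using ne L unfolding f(3)[OF sub(1) y] f(3)[OF sub(2) y] by (auto split: if_splits)
      qed
      then show "S = T" using ST by blast
    qed
    moreover have "cell ` Pow B \<subseteq> cells"
    proof -
      have "\<lfloor>f S x\<rfloor> \<in> {-N..N}" if "S \<subseteq> B" "x \<in> K" for S x
      proof -
        have "\<bar>f S x\<bar> \<le> c * L" using f(2) that K(2) by blast
        then show ?thesis unfolding N_def by (simp add: abs_le_iff) linarith
      qed
      then show ?thesis unfolding cells_def cell_def by auto
    qed
    ultimately have "card (Pow B) \<le> card cells" using fin by (rule card_inj_on_le)
    then have "2 ^ card B \<le> card cells" by (simp add: card_Pow B(2))
    then show ?thesis using less_exp[of "card B"] by linarith
  qed
  then show ?thesis using finite_if_finite_subsets_card_bdd by blast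
qed

text \<open>
  The pieces are indexed by a stratum, by one of countably many closed sets whose union is the
  stratum, and by a tuple of pairwise disjoint members of the network. They cover \<open>Y\<close>: the unique
  support of a point in its stratum consists of \<open>q\<close> distinct points, which lie in disjoint open
  sets and hence in disjoint members of the network.
\<close>

lemma codomain_decomposition:
  assumes \<C>: "countable \<C>" "\<forall>C\<in>\<C>. closedin X C"
    and net: "\<forall>U x. openin X U \<and> x \<in> U \<longrightarrow> (\<exists>C\<in>\<C>. x \<in> C \<and> C \<subseteq> U)"
    and dim: "\<forall>C\<in>\<C>. covering_dim_le (subtopology X C) (d C)"
  obtains A :: "nat \<Rightarrow> 'b set" where "\<forall>n. closedin Y (A n)" "(\<Union>n. A n) = topspace Y"
    "\<forall>n. \<exists>(q::nat) C. (\<forall>i<q. C i \<in> \<C>) \<and> covering_dim_le (subtopology Y (A n)) ((\<Prod>i<q. d (C i) + 1) - 1)"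
proof -
  have "\<exists>F :: nat \<Rightarrow> 'b set. (\<forall>j. closedin Y (F j)) \<and> (\<Union>j. F j) = stratum q (real p)" for q p
    by (rule stratum_fsigma)
  then obtain F :: "nat \<Rightarrow> nat \<Rightarrow> nat \<Rightarrow> 'b set"
    where F: "\<And>q p j. closedin Y (F q p j)" "\<And>q p. (\<Union>j. F q p j) = stratum q (real p)"
    by metis
  define piece where "piece q p j C = {y \<in> F q p j. \<exists>x\<in>PiE {..<q} C. (y, x) \<in> support_graph q (real p)}"
    for q p j and C :: "nat \<Rightarrow> 'a set"
  define dis where "dis q = {C \<in> PiE {..<q} (\<lambda>_. \<C>). \<forall>i<q. \<forall>j<q. i \<noteq> j \<longrightarrow> C i \<inter> C j = {}}" for q :: nat
  have piece: "closedin Y (piece q p j C)"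
      "covering_dim_le (subtopology Y (piece q p j C)) ((\<Prod>i<q. d (C i) + 1) - 1)" if "C \<in> dis q" for q p j C
  proof -
    have C: "C i \<in> \<C>" if "i < q" for i using \<open>C \<in> dis q\<close> that unfolding dis_def by auto
    have disj: "C i \<inter> C j = {}" if "i < q" "j < q" "i \<noteq> j" for i j
      using \<open>C \<in> dis q\<close> that unfolding dis_def by auto
    have uni: "x ` {..<q} = x' ` {..<q}" if "y \<in> F q p j" "(y, x) \<in> support_graph q (real p)"
        "(y, x') \<in> support_graph q (real p)" for y x x'
      using stratum_unique_support(1)[OF _ that(2,3)] F(2) that(1) by blast
    note piece_dim = dim_of_piece[OF F(1) uni finitely_many_points_with_support, where d = "\<lambda>i. d (C i)"]
    show "closedin Y (piece q p j C)"
      unfolding piece_def by (rule piece_dim(1)) (use C \<C>(2) disj dim in auto)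
    show "covering_dim_le (subtopology Y (piece q p j C)) ((\<Prod>i<q. d (C i) + 1) - 1)"
      unfolding piece_def by (rule piece_dim(2)) (use C \<C>(2) disj dim in auto)
  qed
  define \<A> where "\<A> = (\<Union>q. \<Union>p. \<Union>j. piece q p j ` dis q)"
  have "countable (dis q)" for q
    unfolding dis_def using \<C>(1) by (intro countable_Collect countable_PiE) auto
  then have count: "countable \<A>" unfolding \<A>_def by auto
  have "(\<lambda>_. undefined) \<in> dis 0" unfolding dis_def by auto
  then have ne: "\<A> \<noteq> {}" unfolding \<A>_def by blast
  have covers: "y \<in> \<Union>\<A>" if y: "y \<in> topspace Y" for y
  proof -
    obtain q p where qp: "y \<in> stratum q (real p)" using ex_stratum[OF y] by blast
    then obtain j where j: "y \<in> F q p j" using F(2) by blast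
    obtain x where x: "(y, x) \<in> support_graph q (real p)" using qp unfolding stratum_def by force
    have inj: "inj_on x {..<q}" using stratum_unique_support(2)[OF qp x x] .
    have xX: "x ` {..<q} \<subseteq> topspace X" "x \<in> extensional {..<q}"
      using x unfolding support_graph_def by (auto simp: PiE_iff)
    obtain w where w: "\<And>a. a \<in> x ` {..<q} \<Longrightarrow> openin X (w a) \<and> a \<in> w a"
        "\<And>a b. \<lbrakk>a \<in> x ` {..<q}; b \<in> x ` {..<q}; a \<noteq> b\<rbrakk> \<Longrightarrow> w a \<inter> w b = {}"
      using Hausdorff_disjoint_neighbourhoods[OF Hausdorff_X _ xX(1)] by (metis finite_imageI finite_lessThan)
    have "\<exists>C\<in>\<C>. x i \<in> C \<and> C \<subseteq> w (x i)" if "i < q" for i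
      using net w(1)[of "x i"] that by auto
    then obtain C' where C': "\<And>i. i < q \<Longrightarrow> C' i \<in> \<C> \<and> x i \<in> C' i \<and> C' i \<subseteq> w (x i)" by metis
    define C where "C = restrict C' {..<q}"
    have "C i \<inter> C j = {}" if "i < q" "j < q" "i \<noteq> j" for i j
    proof -
      have "x i \<noteq> x j" using inj that by (auto dest: inj_onD)
      then have "w (x i) \<inter> w (x j) = {}" using that by (intro w(2)) auto
      then show ?thesis using C'[OF that(1)] C'[OF that(2)] that unfolding C_def by auto
    qed
    then have "C \<in> dis q" using C' unfolding dis_def C_def by auto
    moreover have "x \<in> PiE {..<q} C" using C' xX(2) unfolding C_def by (auto simp: PiE_iff)
    then have "y \<in> piece q p j C" using j x unfolding piece_def by blast
    ultimately show ?thesis unfolding \<A>_def by blast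
  qed
  have closed: "closedin Y B" if "B \<in> \<A>" for B using that piece(1) unfolding \<A>_def by auto
  show thesis
  proof (rule that[of "from_nat_into \<A>"])
    show "\<forall>n. closedin Y (from_nat_into \<A> n)" using closed from_nat_into[OF ne] by blast
    show "(\<Union>n. from_nat_into \<A> n) = topspace Y"
      using covers closedin_subset[OF closed] range_from_nat_into[OF ne count] by auto
    show "\<forall>n. \<exists>(q::nat) C. (\<forall>i<q. C i \<in> \<C>) \<and>
        covering_dim_le (subtopology Y (from_nat_into \<A> n)) ((\<Prod>i<q. d (C i) + 1) - 1)"
    proof
      fix n
      have "from_nat_into \<A> n \<in> \<A>" by (rule from_nat_into[OF ne])
      then obtain q p j C where C: "C \<in> dis q" "from_nat_into \<A> n = piece q p j C" unfolding \<A>_def by blast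
      then have "\<forall>i<q. C i \<in> \<C>" unfolding dis_def by auto
      then show "\<exists>(q::nat) C. (\<forall>i<q. C i \<in> \<C>) \<and>
          covering_dim_le (subtopology Y (from_nat_into \<A> n)) ((\<Prod>i<q. d (C i) + 1) - 1)"
        unfolding C(2) using piece(2)[OF C(1), of p j] by blast
    qed
  qed
qed

lemma zero_dimensional_Y:
  assumes "zero_dimensional X"
  shows "zero_dimensional Y"
proof -
  obtain \<C> where \<C>: "countable \<C>" "\<forall>C\<in>\<C>. closedin X C"
      "\<forall>U x. openin X U \<and> x \<in> U \<longrightarrow> (\<exists>C\<in>\<C>. x \<in> C \<and> C \<subseteq> U)"
    by (rule countable_closed_network[OF compact_X metrizable_X])
  have "\<forall>C\<in>\<C>. covering_dim_le (subtopology X C) 0"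
    using assms \<C>(2) covering_dim_le_closed_subspace unfolding zero_dimensional_def by blast
  then obtain A :: "nat \<Rightarrow> 'b set" where A: "\<forall>n. closedin Y (A n)" "(\<Union>n. A n) = topspace Y"
    "\<forall>n. \<exists>(q::nat) C. (\<forall>i<q. C i \<in> \<C>) \<and> covering_dim_le (subtopology Y (A n)) ((\<Prod>i<q. 0 + 1) - 1)"
    by (rule codomain_decomposition[OF \<C>, of "\<lambda>_. 0"])
  \<comment> \<open>the bound on the dimension of each piece is \<open>1 ^ q - 1 = 0\<close>\<close>
  have "covering_dim_le Y 0"
    by (rule dim_0_countable_sum[where Z = A]) (use A compact_metrizable_Y Hausdorff_Y in auto)
  then show ?thesis using normal_Y unfolding zero_dimensional_def by blast
qed

text \<open>
  Intersecting the members of a countable network with the given finite-dimensional closed sets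
  yields a countable network of finite-dimensional closed sets.
\<close>

lemma strongly_countable_dimensional_Y:
  assumes "strongly_countable_dimensional X"
  shows "strongly_countable_dimensional Y"
proof -
  obtain B :: "nat \<Rightarrow> 'a set" where B: "\<And>i. closedin X (B i)" "\<And>i. \<exists>n. covering_dim_le (subtopology X (B i)) n"
      "(\<Union>i. B i) = topspace X"
    using assms unfolding strongly_countable_dimensional_def by blast
  obtain \<C> where \<C>: "countable \<C>" "\<forall>C\<in>\<C>. closedin X C"
      "\<forall>U x. openin X U \<and> x \<in> U \<longrightarrow> (\<exists>C\<in>\<C>. x \<in> C \<and> C \<subseteq> U)"
    by (rule countable_closed_network[OF compact_X metrizable_X])
  define \<D> where "\<D> = (\<Union>i. (\<lambda>C. B i \<inter> C) ` \<C>)"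
  have \<D>: "countable \<D>" "\<forall>D\<in>\<D>. closedin X D" unfolding \<D>_def using \<C> B(1) by auto
  have net: "\<forall>U x. openin X U \<and> x \<in> U \<longrightarrow> (\<exists>D\<in>\<D>. x \<in> D \<and> D \<subseteq> U)"
  proof (intro allI impI)
    fix U x assume U: "openin X U \<and> x \<in> U"
    then obtain C where C: "C \<in> \<C>" "x \<in> C" "C \<subseteq> U" using \<C>(3) by blast
    have "x \<in> topspace X" using U openin_subset by blast
    then obtain i where "x \<in> B i" using B(3) by blast
    then show "\<exists>D\<in>\<D>. x \<in> D \<and> D \<subseteq> U"
      using C unfolding \<D>_def by (intro bexI[of _ "B i \<inter> C"]) auto
  qed
  have "\<exists>n. covering_dim_le (subtopology X D) n" if "D \<in> \<D>" for D
  proof -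
    obtain i C where D: "D = B i \<inter> C" "C \<in> \<C>" using \<open>D \<in> \<D>\<close> unfolding \<D>_def by blast
    obtain n where "covering_dim_le (subtopology X (B i)) n" using B(2) by blast
    moreover have "closedin (subtopology X (B i)) D"
      unfolding D(1) using \<C>(2) D(2) by (auto simp: closedin_subtopology)
    ultimately have "covering_dim_le (subtopology (subtopology X (B i)) D) n"
      by (rule covering_dim_le_closed_subspace)
    moreover have "subtopology (subtopology X (B i)) D = subtopology X D"
      unfolding D(1) by (simp add: subtopology_subtopology)
    ultimately show ?thesis by auto
  qed
  then obtain d where "\<forall>D\<in>\<D>. covering_dim_le (subtopology X D) (d D)" by metis
  then obtain A :: "nat \<Rightarrow> 'b set" where A: "\<forall>n. closedin Y (A n)" "(\<Union>n. A n) = topspace Y"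
    "\<forall>n. \<exists>(q::nat) C. (\<forall>i<q. C i \<in> \<D>) \<and> covering_dim_le (subtopology Y (A n)) ((\<Prod>i<q. d (C i) + 1) - 1)"
    by (rule codomain_decomposition[OF \<D> net])
  have "\<exists>m. covering_dim_le (subtopology Y (A n)) m" for n
    using A(3)[THEN spec, of n] by (elim exE conjE) (rule exI)
  then show ?thesis
    using normal_Y A(1,2) unfolding strongly_countable_dimensional_def by (intro conjI exI[of _ A]) auto
qed

end

theorem theorem4p2:
  fixes X :: "'a topology" and Y :: "'b topology"
    and \<phi> :: "('a \<Rightarrow> real) \<Rightarrow> ('b \<Rightarrow> real)" and c :: real
  assumes "compact_space X" and "metrizable_space X"
    and "tychonoff_space Y"
    and "Cp_uniformly_continuous X Y \<phi>"
    and "\<phi> ` topspace (Cp X) = topspace (Cp Y)"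
    and "c > 0" and "c_good c X Y \<phi>"
  shows "compact_space Y \<and> metrizable_space Y \<and>
    (zero_dimensional X \<longrightarrow> zero_dimensional Y) \<and>
    (strongly_countable_dimensional X \<longrightarrow> strongly_countable_dimensional Y)"
proof -
  interpret c_good_surjection X Y \<phi> c
    using assms by unfold_locales
  show ?thesis
    using compact_metrizable_Y zero_dimensional_Y strongly_countable_dimensional_Y by blast
qed

end
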